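(* Let $m,n\in\mathbb N$. The set $\widetilde{\mathcal{BA}}_{m,n}$ of badly approximable systems of $m$ affine forms in $n$ variables is thick in $\tilde M_{m,n}(\mathbb R)=M_{m,n}(\mathbb R)\times\mathbb R^m$.
   Context: $M_{m,n}(\mathbb R)$ denotes the space of real $m\times n$ matrices, and $\tilde M_{m,n}(\mathbb R)=M_{m,n}(\mathbb R)\times\mathbb R^m$ (a Euclidean space of dimension $mn+m$). On $\mathbb R^k$ the norm is $\|\mathbf x\|=\max_i|x_i|$. A pair $\langle A,\mathbf b\rangle\in\tilde M_{m,n}(\mathbb R)$ (a system of affine forms) is called badly approximable if $$\liminf_{\mathbf p\in\mathbb Z^m,\ \mathbf q\in\mathbb Z^n,\ \mathbf q\to\infty}\|A\mathbf q+\mathbf b+\mathbf p\|^m\|\mathbf q\|^n>0,$$ and $\widetilde{\mathcal{BA}}_{m,n}$ is the set of all badly approximable $\langle A,\mathbf b\rangle$. A subset $Y$ of a metric space $X$ is called thick in $X$ if for every nonempty open $W\subseteq X$ one has $\dim(W\cap Y)=\dim(W)$, where $\dim$ denotes Hausdorff dimension. *)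

theory Defs
  imports "HOL-Analysis.Analysis"
begin

text \<open>The library's \<^const>\<open>diameter\<close> is meaningless on unbounded sets, so covers are
  required to consist of bounded sets. An infimum over no covers at all is \<open>\<infinity>\<close>.\<close>

definition hausdorff_premeasure :: "real \<Rightarrow> real \<Rightarrow> 'a::metric_space set \<Rightarrow> ennreal" where
  "hausdorff_premeasure s \<delta> E =
     (INF U \<in> {U :: nat \<Rightarrow> 'a set. E \<subseteq> (\<Union>i. U i) \<and> (\<forall>i. bounded (U i) \<and> diameter (U i) \<le> \<delta>)}.
        \<Sum>i. ennreal (diameter (U i) powr s))"

definition hausdorff_measure :: "real \<Rightarrow> 'a::metric_space set \<Rightarrow> ennreal" where
  "hausdorff_measure s E = (SUP \<delta> \<in> {0<..}. hausdorff_premeasure s \<delta> E)"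

text \<open>Only \<open>s > 0\<close> is used, which avoids the convention for \<open>0\<^sup>0\<close> in the measure of
  exponent 0 and does not change the infimum. The empty set has dimension 0.\<close>

definition hausdorff_dim :: "'a::metric_space set \<Rightarrow> ereal" where
  "hausdorff_dim E = (INF s \<in> {s::real. 0 < s \<and> hausdorff_measure s E = 0}. ereal s)"

definition thick_in :: "'a::metric_space set \<Rightarrow> 'a set \<Rightarrow> bool" where
  "thick_in X Y \<longleftrightarrow> Y \<subseteq> X \<and>
     (\<forall>W. openin (top_of_set X) W \<and> W \<noteq> {} \<longrightarrow> hausdorff_dim (W \<inter> Y) = hausdorff_dim W)"

definition real_vec :: "int ^ 'k \<Rightarrow> real ^ 'k" where
  "real_vec v = (\<chi> i. real_of_int (v $ i))"

text \<open>The norm on \<open>\<real>\<^sup>k\<close> is the maximum norm \<^const>\<open>infnorm\<close>. The filter below expresses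
  \<open>q \<rightarrow> \<infinity>\<close> with no restriction on \<open>p\<close>.\<close>

definition badly_approximable :: "(real ^ 'n ^ 'm) \<times> (real ^ 'm) \<Rightarrow> bool" where
  "badly_approximable = (\<lambda>(A, b).
     Liminf (filtercomap (\<lambda>(p :: int ^ 'm, q :: int ^ 'n). infnorm (real_vec q)) at_top)
       (\<lambda>(p, q). ereal (infnorm (A *v real_vec q + b + real_vec p) ^ CARD('m)
                        * infnorm (real_vec q) ^ CARD('n))) > 0)"

definition BA_affine :: "((real ^ 'n ^ 'm) \<times> (real ^ 'm)) set" where
  "BA_affine = {S. badly_approximable S}"

end

theory Submission
  imports Defs
begin

text \<open>Fix \<open>A\<close> and put \<open>R = S\<^sup>n\<close>. Dirichlet's theorem for the transposed system gives integer
  vectors \<open>y\<^sub>j\<close> with \<open>\<bar>y\<^sub>j\<bar> \<le> R\<^sup>j\<close> and \<open>A\<^sup>T y\<^sub>j\<close> within \<open>S\<close> to the power \<open>-mj\<close> of an integer vector, and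
  by transference \<open>(A, b)\<close> is badly approximable as soon as all \<open>b \<bullet> y\<^sub>j\<close> stay away from the
  integers. The \<open>y\<^sub>j\<close> can be chosen so that each either repeats its predecessor or is longer than
  \<open>R\<close> to the power \<open>j - 1\<close>. Hence in a tree of cubes whose side shrinks by the factor \<open>R\<close>, each level
  discards only the children along one hyperplane strip.

  Given sets \<open>F\<^sub>i\<close> with small \<open>\<Sum>i. (diam F\<^sub>i)\<^sup>s\<close>, \<open>s < m\<close>, one descends through this tree, choosing at
  each level a child for which the sum over the \<open>F\<^sub>i\<close> hitting it is small relative to its side. The
  limit point lies in no \<open>F\<^sub>i\<close>. So no such family covers the fibre over \<open>A\<close>, with a bound that does
  not depend on \<open>A\<close>. A cover of \<open>W \<inter> BA\<close> with small \<open>(mn + s)\<close>-content would, after integration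
  over \<open>A\<close>, yield such a family for some \<open>A\<close>.\<close>

section \<open>Hausdorff measure and dimension\<close>

lemma ennreal_le_suminf: "f i \<le> (\<Sum>i. f i)" for f :: "nat \<Rightarrow> ennreal"
  using sum_le_suminf[OF summableI, of "{i}" f] by simp

lemma hausdorff_measure_mono:
  "E \<subseteq> F \<Longrightarrow> hausdorff_measure s E \<le> hausdorff_measure s F"
  unfolding hausdorff_measure_def hausdorff_premeasure_def
  by (rule SUP_mono') (rule INF_superset_mono, auto)

lemma hausdorff_dim_mono:
  assumes "E \<subseteq> F"
  shows "hausdorff_dim E \<le> hausdorff_dim F"
  unfolding hausdorff_dim_def
proof (rule INF_superset_mono)
  show "{s. 0 < s \<and> hausdorff_measure s F = 0} \<subseteq> {s. 0 < s \<and> hausdorff_measure s E = 0}"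
    using hausdorff_measure_mono[OF assms] by (metis (mono_tags, lifting) Collect_mono le_zero_eq)
qed simp

text \<open>Each summand is at most the whole sum, so a total below \<open>\<delta> powr s\<close>
  already forces every diameter below \<open>\<delta>\<close>. For nullity the mesh restriction can
  therefore be dropped.\<close>

lemma hausdorff_measure_eq_0_iff:
  assumes "0 < s"
  shows "hausdorff_measure s E = 0 \<longleftrightarrow>
    (\<forall>\<epsilon>>0. \<exists>U::nat \<Rightarrow> _. E \<subseteq> (\<Union>i. U i) \<and> (\<forall>i. bounded (U i)) \<and>
      (\<Sum>i. ennreal (diameter (U i) powr s)) < ennreal \<epsilon>)" (is "?L \<longleftrightarrow> ?R")
proof
  assume L: ?L
  have "hausdorff_premeasure s 1 E \<le> 0"
    using L unfolding hausdorff_measure_def by (metis SUP_upper greaterThan_iff zero_less_one)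
  show ?R
  proof (intro allI impI)
    fix \<epsilon> :: real assume "\<epsilon> > 0"
    then have "hausdorff_premeasure s 1 E < ennreal \<epsilon>"
      using \<open>hausdorff_premeasure s 1 E \<le> 0\<close> by (metis ennreal_less_zero_iff le_zero_eq)
    then obtain U :: "nat \<Rightarrow> _" where "E \<subseteq> (\<Union>i. U i)" "\<forall>i. bounded (U i) \<and> diameter (U i) \<le> 1"
        "(\<Sum>i. ennreal (diameter (U i) powr s)) < ennreal \<epsilon>"
      unfolding hausdorff_premeasure_def by (auto simp: INF_less_iff)
    then show "\<exists>U::nat \<Rightarrow> _. E \<subseteq> (\<Union>i. U i) \<and> (\<forall>i. bounded (U i)) \<and>
      (\<Sum>i. ennreal (diameter (U i) powr s)) < ennreal \<epsilon>" by (intro exI[of _ U]) auto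
  qed
next
  assume R: ?R
  have "hausdorff_premeasure s \<delta> E \<le> 0" if "\<delta> > 0" for \<delta>
  proof (rule ennreal_le_epsilon)
    fix e :: real assume "e > 0"
    define \<epsilon> where "\<epsilon> = min e (\<delta> powr s)"
    have "\<epsilon> > 0" unfolding \<epsilon>_def using \<open>e > 0\<close> that by simp
    from R[rule_format, OF this] obtain U :: "nat \<Rightarrow> _" where U: "E \<subseteq> (\<Union>i. U i)" "\<forall>i. bounded (U i)"
        and sU: "(\<Sum>i. ennreal (diameter (U i) powr s)) < ennreal \<epsilon>"
      by (elim exE conjE) (rule that)
    have "diameter (U i) \<le> \<delta>" for i
    proof -
      have "ennreal (diameter (U i) powr s) \<le> (\<Sum>i. ennreal (diameter (U i) powr s))"
        by (rule ennreal_le_suminf)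
      also have "\<dots> < ennreal \<epsilon>" by (rule sU)
      finally have "diameter (U i) powr s < \<delta> powr s"
        by (simp add: ennreal_less_iff \<epsilon>_def)
      then show ?thesis
        using powr_less_mono2[of s \<delta> "diameter (U i)"] assms \<open>\<delta> > 0\<close> by (cases "diameter (U i) \<le> \<delta>") auto
    qed
    then have "hausdorff_premeasure s \<delta> E \<le> (\<Sum>i. ennreal (diameter (U i) powr s))"
      unfolding hausdorff_premeasure_def using U by (intro INF_lower) auto
    also have "\<dots> \<le> ennreal e"
      using sU by (metis \<epsilon>_def ennreal_leI min.cobounded1 order.strict_implies_order order.trans)
    finally show "hausdorff_premeasure s \<delta> E \<le> 0 + ennreal e" by simp
  qed
  then show ?L
    unfolding hausdorff_measure_def by (metis (no_types, lifting) SUP_least greaterThan_iff le_zero_eq)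
qed

lemma hausdorff_measure_countable_UN_eq_0:
  fixes E :: "nat \<Rightarrow> 'a::metric_space set"
  assumes "0 < s" and null: "\<And>k. hausdorff_measure s (E k) = 0"
  shows "hausdorff_measure s (\<Union>k. E k) = 0"
  unfolding hausdorff_measure_eq_0_iff[OF \<open>0 < s\<close>]
proof (intro allI impI)
  fix \<epsilon> :: real assume "\<epsilon> > 0"
  \<comment> \<open>The allowances add up to \<open>\<epsilon> / 2\<close> rather than
    \<open>\<epsilon>\<close>, because summation preserves only the weak inequality.\<close>
  have "\<exists>U::nat \<Rightarrow> _. E k \<subseteq> (\<Union>i. U i) \<and> (\<forall>i. bounded (U i)) \<and>
      (\<Sum>i. ennreal (diameter (U i) powr s)) < ennreal (\<epsilon> / 2 * (1/2) ^ Suc k)" for k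
    using null[of k] \<open>\<epsilon> > 0\<close> unfolding hausdorff_measure_eq_0_iff[OF \<open>0 < s\<close>] by (auto intro!: zero_less_mult_iff[THEN iffD2])
  then obtain U :: "nat \<Rightarrow> nat \<Rightarrow> _" where U: "\<And>k. E k \<subseteq> (\<Union>i. U k i)" "\<And>k i. bounded (U k i)"
    and sU: "\<And>k. (\<Sum>i. ennreal (diameter (U k i) powr s)) < ennreal (\<epsilon> / 2 * (1/2) ^ Suc k)"
    by metis
  define V where "V = (\<lambda>n. case prod_decode n of (k, i) \<Rightarrow> U k i)"
  have "(\<Union>k. E k) \<subseteq> (\<Union>n. V n)"
  proof
    fix x assume "x \<in> (\<Union>k. E k)"
    then obtain k i where "x \<in> U k i" using U(1) by blast
    then have "x \<in> V (prod_encode (k, i))" by (simp add: V_def)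
    then show "x \<in> (\<Union>n. V n)" by blast
  qed
  moreover have "\<forall>n. bounded (V n)" using U(2) by (simp add: V_def split: prod.split)
  moreover have "(\<Sum>n. ennreal (diameter (V n) powr s)) < ennreal \<epsilon>"
  proof -
    have "(\<Sum>n. ennreal (diameter (V n) powr s))
        = (\<Sum>n. (\<lambda>(k, i). ennreal (diameter (U k i) powr s)) (prod_decode n))"
      by (simp add: V_def case_prod_beta)
    also have "\<dots> = (\<Sum>k. \<Sum>i. ennreal (diameter (U k i) powr s))"
      by (rule suminf_ennreal_2dimen) simp
    also have "\<dots> \<le> (\<Sum>k. ennreal (\<epsilon> / 2 * (1/2) ^ Suc k))"
      by (intro suminf_le less_imp_le sU summableI)
    also have "\<dots> = ennreal (\<epsilon> / 2)"
      using sums_mult[OF power_half_series, of "\<epsilon>/2"] \<open>\<epsilon> > 0\<close>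
      by (intro suminf_ennreal_eq) auto
    also have "\<dots> < ennreal \<epsilon>" using \<open>\<epsilon> > 0\<close> by (simp add: ennreal_less_iff)
    finally show ?thesis .
  qed
  ultimately show "\<exists>V::nat \<Rightarrow> _. (\<Union>k. E k) \<subseteq> (\<Union>n. V n) \<and> (\<forall>n. bounded (V n)) \<and>
      (\<Sum>n. ennreal (diameter (V n) powr s)) < ennreal \<epsilon>" by blast
qed

section \<open>Upper bound for the dimension of subsets of a Euclidean space\<close>

lemma hausdorff_measure_cball_eq_0:
  fixes s r :: real
  assumes s: "DIM('a::euclidean_space) < s" and r: "0 < r"
  shows "hausdorff_measure s (cball (0::'a) r) = 0"
proof -
  let ?N = "DIM('a)"
  have "0 < s" using s by (meson le_less_trans of_nat_0_le_iff)
  \<comment> \<open>\<open>C\<close> collects the factors free of \<open>K\<close>: at most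
    \<open>(3 * K) ^ ?N\<close> balls of diameter \<open>2 * ?N * r / K\<close> have total weight at
    most \<open>C * K powr (?N - s)\<close>, which tends to 0.\<close>
  define C where "C = 3 ^ ?N * (2 * (?N * r)) powr s"
  show ?thesis unfolding hausdorff_measure_eq_0_iff[OF \<open>0 < s\<close>]
  proof (intro allI impI)
    fix \<epsilon> :: real assume "\<epsilon> > 0"
    have "(\<lambda>K. C * real K powr (?N - s)) \<longlonglongrightarrow> C * 0"
      using s by (intro tendsto_mult tendsto_const tendsto_neg_powr filterlim_real_sequentially) auto
    then have "\<forall>\<^sub>F K in sequentially. C * real K powr (?N - s) < \<epsilon>"
      using \<open>\<epsilon> > 0\<close> by (auto dest: order_tendstoD)
    then obtain K where "K \<ge> 1" and CK: "C * real K powr (?N - s) < \<epsilon>"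
      unfolding eventually_sequentially by (metis nat_le_linear)
    define h where "h = r / K"
    have "h > 0" using r \<open>K \<ge> 1\<close> by (simp add: h_def)
    define P where "P = PiE (Basis::'a set) (\<lambda>_. {- int K..int K})"
    have "finite P" by (simp add: P_def finite_PiE)
    have cardP: "card P = (2 * K + 1) ^ ?N" by (simp add: P_def card_PiE nat_add_distrib nat_mult_distrib)
    obtain g where g: "bij_betw g {..<card P} P"
      using ex_bij_betw_nat_finite[OF \<open>finite P\<close>] by (auto simp: atLeast0LessThan)
    define pt where "pt v = (\<Sum>b\<in>Basis. (of_int (v b) * h) *\<^sub>R b :: 'a)" for v
    \<comment> \<open>Each coordinate of a point is within \<open>h\<close> of its grid point, so
      the l1 bound on the norm makes the radius \<open>?N * h\<close> sufficient. Empty sets pad the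
      sequence at no cost.\<close>
    define U where "U i = (if i < card P then cball (pt (g i)) (?N * h) else {})" for i
    have "cball 0 r \<subseteq> (\<Union>i. U i)"
    proof
      fix x :: 'a assume "x \<in> cball 0 r"
      define v where "v = restrict (\<lambda>b. \<lfloor>(x \<bullet> b) / h\<rfloor>) Basis"
      have "v \<in> P"
      proof -
        have "\<lfloor>(x \<bullet> b) / h\<rfloor> \<in> {- int K..int K}" if "b \<in> Basis" for b
        proof -
          have "\<bar>x \<bullet> b\<bar> \<le> r" using Basis_le_norm[OF that, of x] \<open>x \<in> cball 0 r\<close> by simp
          also have "r = K * h" using \<open>K \<ge> 1\<close> by (simp add: h_def)
          finally have "- real K \<le> (x \<bullet> b) / h" "(x \<bullet> b) / h \<le> K"
            using \<open>h > 0\<close> by (auto simp: field_simps abs_le_iff)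
          then show ?thesis by (simp add: le_floor_iff floor_le_iff)
        qed
        then show ?thesis by (auto simp: P_def v_def)
      qed
      then obtain i where "i < card P" "v = g i"
        using g by (auto simp: bij_betw_def)
      have "norm (x - pt v) \<le> (\<Sum>b\<in>Basis. \<bar>(x - pt v) \<bullet> b\<bar>)" by (rule norm_le_l1)
      also have "\<dots> \<le> (\<Sum>b\<in>(Basis::'a set). h)"
      proof (rule sum_mono)
        fix b :: 'a assume b: "b \<in> Basis"
        have "pt v \<bullet> b = of_int (v b) * h"
          unfolding pt_def using b by simp
        moreover have "\<bar>x \<bullet> b / h - of_int \<lfloor>x \<bullet> b / h\<rfloor>\<bar> \<le> 1" by linarith
        ultimately show "\<bar>(x - pt v) \<bullet> b\<bar> \<le> h"
          using \<open>h > 0\<close> b by (simp add: v_def inner_diff_left abs_le_iff field_simps)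
      qed
      finally have "x \<in> U i" using \<open>i < card P\<close> \<open>v = g i\<close>
        by (simp add: U_def dist_norm norm_minus_commute)
      then show "x \<in> (\<Union>i. U i)" by blast
    qed
    moreover have "\<forall>i. bounded (U i)" by (simp add: U_def)
    moreover have "(\<Sum>i. ennreal (diameter (U i) powr s)) < ennreal \<epsilon>"
    proof -
      have "(\<Sum>i. ennreal (diameter (U i) powr s)) = (\<Sum>i<card P. ennreal (diameter (U i) powr s))"
        by (rule suminf_finite) (auto simp: U_def)
      also have "\<dots> = (\<Sum>i<card P. ennreal ((2 * (?N * h)) powr s))"
        using \<open>h > 0\<close> by (intro sum.cong) (auto simp: U_def mult_less_0_iff)
      also have "\<dots> = ennreal (card P * (2 * (?N * h)) powr s)"
        by (simp add: ennreal_mult ennreal_of_nat_eq_real_of_nat)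
      also have "card P * (2 * (?N * h)) powr s \<le> (3 * real K) ^ ?N * (2 * (?N * h)) powr s"
        unfolding cardP of_nat_power using \<open>K \<ge> 1\<close> by (intro mult_right_mono power_mono) auto
      also have "(2 * (?N * h)) powr s = (2 * (?N * r)) powr s / K powr s"
        using r \<open>K \<ge> 1\<close> by (simp add: h_def flip: powr_divide)
      also have "(3 * real K) ^ ?N * ((2 * (?N * r)) powr s / K powr s) = C * (real K ^ ?N / K powr s)"
        by (simp add: C_def power_mult_distrib)
      also have "real K ^ ?N / K powr s = K powr (?N - s)"
        using \<open>K \<ge> 1\<close> by (simp add: powr_diff powr_realpow)
      finally show ?thesis using CK \<open>\<epsilon> > 0\<close> by (meson ennreal_leI ennreal_lessI order.strict_trans1)
    qed
    ultimately show "\<exists>U::nat \<Rightarrow> _. cball (0::'a) r \<subseteq> (\<Union>i. U i) \<and> (\<forall>i. bounded (U i)) \<and>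
      (\<Sum>i. ennreal (diameter (U i) powr s)) < ennreal \<epsilon>" by blast
  qed
qed

text \<open>The space is a countable union of balls, each null for every exponent above the
  dimension.\<close>

lemma hausdorff_dim_le_DIM:
  fixes E :: "'a::euclidean_space set"
  shows "hausdorff_dim E \<le> ereal DIM('a)"
proof (rule ereal_le_epsilon2)
  fix e :: real assume "e > 0"
  have "x \<in> (\<Union>k. cball 0 (real (Suc k)))" for x :: 'a
    using real_arch_simple[of "norm x"] by (auto intro!: exI[of _ "nat \<lceil>norm x\<rceil>"]) linarith
  then have "UNIV = (\<Union>k. cball (0::'a) (real (Suc k)))" by blast
  moreover have "hausdorff_measure (DIM('a) + e) (\<Union>k. cball (0::'a) (real (Suc k))) = 0"
    using \<open>e > 0\<close> by (intro hausdorff_measure_countable_UN_eq_0 hausdorff_measure_cball_eq_0) (auto intro: add_nonneg_pos)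
  ultimately have "hausdorff_measure (DIM('a) + e) E = 0"
    using hausdorff_measure_mono[of E UNIV "DIM('a) + e"] by simp
  then have "hausdorff_dim E \<le> ereal (DIM('a) + e)"
    unfolding hausdorff_dim_def using \<open>e > 0\<close> by (intro INF_lower) (auto intro: add_nonneg_pos)
  then show "hausdorff_dim E \<le> ereal DIM('a) + ereal e" by simp
qed

section \<open>Avoiding strips and small sets in a tree of cubes\<close>

definition cube :: "real ^ 'm \<Rightarrow> real \<Rightarrow> (real ^ 'm) set" where
  "cube a l = {x. \<forall>k. a $ k \<le> x $ k \<and> x $ k \<le> a $ k + l}"

definition subcube_corner :: "real ^ 'm \<Rightarrow> real \<Rightarrow> nat \<Rightarrow> ('m \<Rightarrow> nat) \<Rightarrow> real ^ 'm" where
  "subcube_corner a l M u = (\<chi> k. a $ k + l / M * u k)"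

text \<open>Only every other subcube of the grid of mesh \<open>l / (2 * M)\<close> is used, so that a set of
  diameter less than \<open>l / (2 * M)\<close> meets at most one of them.\<close>

abbreviation subcube :: "real ^ 'm \<Rightarrow> real \<Rightarrow> nat \<Rightarrow> ('m \<Rightarrow> nat) \<Rightarrow> (real ^ 'm) set" where
  "subcube a l M u \<equiv> cube (subcube_corner a l M u) (l / (2 * real M))"

lemma cube_eq_cbox: "cube a l = cbox a (\<chi> k. a $ k + l)"
  by (auto simp: cube_def mem_box_cart)

lemma compact_cube: "compact (cube a l)"
  by (simp add: cube_eq_cbox)

lemma cube_nonempty: "0 \<le> l \<Longrightarrow> cube a l \<noteq> {}"
  by (auto simp: cube_def intro: exI[of _ a])

lemma subcube_subset:
  fixes l :: real
  assumes "0 < l" "0 < M" "\<And>k. u k < M"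
  shows "subcube a l M u \<subseteq> cube a l"
proof
  fix x assume x: "x \<in> subcube a l M u"
  have "a $ k \<le> x $ k \<and> x $ k \<le> a $ k + l" for k
  proof -
    have "real (u k) \<le> real M - 1" using assms(3)[of k] by linarith
    then have "l / M * u k \<le> l / M * (real M - 1)"
      using assms(1,2) by (intro mult_left_mono) auto
    also have "\<dots> = l - l / M" using assms by (simp add: field_simps)
    finally have "l / M * u k + l / (2 * real M) \<le> l"
      using assms by (simp add: field_simps)
    moreover have "0 \<le> l / M * u k" using assms by simp
    moreover have "a $ k + l / M * u k \<le> x $ k \<and> x $ k \<le> a $ k + l / M * u k + l / (2 * real M)"
      using x by (simp add: cube_def subcube_corner_def)
    ultimately show ?thesis by linarith
  qed
  then show "x \<in> cube a l" by (simp add: cube_def)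
qed

lemma dist_subcubes_ge:
  fixes l :: real
  assumes "0 < l" "0 < M" "x \<in> subcube a l M u" "y \<in> subcube a l M v" "u \<noteq> v"
  shows "l / (2 * real M) \<le> dist x y"
proof -
  obtain k where "u k \<noteq> v k" using \<open>u \<noteq> v\<close> by blast
  define h where "h = l / (2 * real M)"
  have "0 < h" using assms by (simp add: h_def)
  have lM: "l / M = 2 * h" by (simp add: h_def)
  have x: "a $ k + 2 * h * u k \<le> x $ k" "x $ k \<le> a $ k + 2 * h * u k + h"
   and y: "a $ k + 2 * h * v k \<le> y $ k" "y $ k \<le> a $ k + 2 * h * v k + h"
    using assms(3,4) by (simp_all add: cube_def subcube_corner_def lM flip: h_def)
  have "1 \<le> \<bar>real (u k) - real (v k)\<bar>" using \<open>u k \<noteq> v k\<close> by linarith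
  then have "2 * h * 1 \<le> 2 * h * \<bar>real (u k) - real (v k)\<bar>"
    using \<open>0 < h\<close> by (intro mult_left_mono) auto
  also have "\<dots> = \<bar>2 * h * u k - 2 * h * v k\<bar>"
    using \<open>0 < h\<close> by (simp add: abs_mult flip: right_diff_distrib)
  finally have "h \<le> \<bar>x $ k - y $ k\<bar>" using x y \<open>0 < h\<close> by linarith
  also have "\<dots> \<le> dist x y" by (metis component_le_norm_cart dist_norm vector_minus_component)
  finally show ?thesis by (simp add: h_def)
qed

section \<open>Counting the subcubes that come close to integer hyperplanes\<close>

lemma abs_inner_le_cart:
  fixes x z :: "real ^ 'm"
  assumes "\<And>k. \<bar>x $ k\<bar> \<le> c"
  shows "\<bar>x \<bullet> z\<bar> \<le> CARD('m) * (c * infnorm z)"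
proof -
  have "\<bar>x \<bullet> z\<bar> \<le> (\<Sum>k\<in>UNIV. \<bar>x $ k * z $ k\<bar>)"
    by (simp add: inner_vec_def)
  also have "\<dots> \<le> (\<Sum>k\<in>(UNIV::'m set). c * infnorm z)"
  proof (rule sum_mono)
    fix k
    show "\<bar>x $ k * z $ k\<bar> \<le> c * infnorm z"
      unfolding abs_mult using assms[of k] component_le_infnorm_cart[of z k]
      by (intro mult_mono) auto
  qed
  finally show ?thesis by simp
qed

lemma infnorm_attained_cart:
  fixes z :: "real ^ 'm"
  obtains k where "\<bar>z $ k\<bar> = infnorm z"
proof -
  have "infnorm z = Max (range (\<lambda>i. \<bar>z $ i\<bar>))"
    unfolding infnorm_cart by (subst cSup_eq_Max[symmetric]) (auto simp: full_SetCompr_eq)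
  moreover have "Max (range (\<lambda>i. \<bar>z $ i\<bar>)) \<in> range (\<lambda>i. \<bar>z $ i\<bar>)"
    by (rule Max_in) auto
  ultimately show ?thesis using that by force
qed

text \<open>Along the coordinate in which \<open>z\<close> is largest, the bad subcubes of each line lie
  within a distance of \<open>CARD('m)\<close> steps, so their position modulo \<open>CARD('m) + 1\<close> determines
  them.\<close>

lemma card_bad_subcubes_le:
  fixes a z :: "real ^ 'm" and l \<gamma> :: real
  assumes l: "0 < l" and M: "0 < M" and \<gamma>: "0 < \<gamma>" "\<gamma> \<le> 1/8"
    and z1: "l * CARD('m) * infnorm z \<le> 1/2" and z2: "4 * real M * \<gamma> \<le> l * infnorm z"
  shows "card {u \<in> UNIV \<rightarrow> {..<M}. \<exists>b\<in>subcube a l M u. \<exists>p::int. \<bar>b \<bullet> z - p\<bar> < \<gamma>}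
           \<le> (CARD('m) + 1) * M ^ (CARD('m) - 1)" (is "card ?B \<le> _")
proof -
  let ?m = "CARD('m)"
  obtain k0 where k0: "\<bar>z $ k0\<bar> = infnorm z" by (rule infnorm_attained_cart)
  define h where "h = l / (2 * real M)"
  have "0 < h" using l M by (simp add: h_def)
  have lM: "l / M = 2 * h" by (simp add: h_def)
  have Z: "0 < infnorm z"
  proof -
    have "0 < 4 * real M * \<gamma>" using M \<gamma> by simp
    with z2 l show ?thesis by (metis less_le_trans zero_less_mult_pos)
  qed
  define \<phi> where "\<phi> u = u(k0 := u k0 mod (?m + 1))" for u :: "'m \<Rightarrow> nat"
  define T where "T = PiE (UNIV::'m set) (\<lambda>k. if k = k0 then {..<?m + 1} else {..<M})"
  have "finite T" by (auto simp: T_def intro!: finite_PiE)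
  have "card T = (\<Prod>k\<in>(UNIV::'m set). if k = k0 then ?m + 1 else M)"
    by (simp add: T_def card_PiE if_distrib cong: if_cong)
  also have "\<dots> = (?m + 1) * M ^ (?m - 1)"
    by (subst prod.remove[of _ k0]) (auto simp: card_Diff_singleton)
  finally have cardT: "card T = (?m + 1) * M ^ (?m - 1)" .
  have "\<phi> ` ?B \<subseteq> T"
    by (auto simp: \<phi>_def T_def Pi_iff)
  moreover have "inj_on \<phi> ?B"
  proof (rule inj_onI)
    fix u v assume "u \<in> ?B" "v \<in> ?B" and eq: "\<phi> u = \<phi> v"
    then obtain b p c q where b: "b \<in> subcube a l M u" "\<bar>b \<bullet> z - of_int p\<bar> < \<gamma>"
      and c: "c \<in> subcube a l M v" "\<bar>c \<bullet> z - of_int q\<bar> < \<gamma>" by blast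
    have uv: "\<And>k. u k < M" "\<And>k. v k < M" using \<open>u \<in> ?B\<close> \<open>v \<in> ?B\<close> by auto
    have off: "u k = v k" if "k \<noteq> k0" for k
      using fun_cong[OF eq, of k] that by (simp add: \<phi>_def)
    have mod: "u k0 mod (?m + 1) = v k0 mod (?m + 1)"
      using fun_cong[OF eq, of k0] by (simp add: \<phi>_def)
    have bk: "a $ k + 2 * h * u k \<le> b $ k \<and> b $ k \<le> a $ k + 2 * h * u k + h" for k
      using b(1) by (simp add: cube_def subcube_corner_def lM flip: h_def)
    have ck: "a $ k + 2 * h * v k \<le> c $ k \<and> c $ k \<le> a $ k + 2 * h * v k + h" for k
      using c(1) by (simp add: cube_def subcube_corner_def lM flip: h_def)
    have "\<bar>(b - c) $ k\<bar> \<le> l" for k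
    proof -
      have "b \<in> cube a l" "c \<in> cube a l"
        using subcube_subset[OF l M, of u] subcube_subset[OF l M, of v] b(1) c(1) uv by blast+
      then have "a $ k \<le> b $ k \<and> b $ k \<le> a $ k + l" "a $ k \<le> c $ k \<and> c $ k \<le> a $ k + l"
        by (simp_all add: cube_def)
      then show ?thesis by (simp add: abs_le_iff)
    qed
    \<comment> \<open>This and \<open>2 * \<gamma> \<le> 1/4\<close> put \<open>p\<close> and
      \<open>q\<close> at distance less than 1, so both points are near the same hyperplane.\<close>
    then have "\<bar>(b - c) \<bullet> z\<bar> \<le> 1/2"
      using abs_inner_le_cart[of "b - c" l z] z1 by (simp add: mult_ac)
    then have "\<bar>real_of_int p - of_int q\<bar> < 1"
      using b(2) c(2) \<gamma> unfolding inner_diff_left by linarith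
    then have "p = q" by linarith
    then have "\<bar>(b - c) \<bullet> z\<bar> < 2 * \<gamma>"
      using b(2) c(2) unfolding inner_diff_left by linarith
    also have "\<dots> \<le> h * infnorm z" using z2 M by (simp add: h_def field_simps)
    finally have small: "\<bar>(b - c) \<bullet> z\<bar> < h * infnorm z" .
    \<comment> \<open>Outside \<open>k0\<close> the indices agree, so each of the other
      \<open>?m - 1\<close> terms is at most \<open>h * infnorm z\<close>. As the total is small,
      the \<open>k0\<close> term is below \<open>?m * h * infnorm z\<close>.\<close>
    have "(b - c) \<bullet> z = (b - c) $ k0 * z $ k0 + (\<Sum>k\<in>UNIV - {k0}. (b - c) $ k * z $ k)"
      unfolding inner_vec_def by (subst sum.remove[of _ k0]) auto
    moreover have "\<bar>\<Sum>k\<in>UNIV - {k0}. (b - c) $ k * z $ k\<bar> \<le> (\<Sum>k\<in>UNIV - {k0}. h * infnorm z)"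
    proof (rule order_trans[OF sum_abs sum_mono])
      fix k assume "k \<in> UNIV - {k0}"
      then have "\<bar>(b - c) $ k\<bar> \<le> h"
        using bk[of k] ck[of k] off[of k] by (auto simp: abs_le_iff)
      then show "\<bar>(b - c) $ k * z $ k\<bar> \<le> h * infnorm z"
        unfolding abs_mult using component_le_infnorm_cart[of z k] \<open>0 < h\<close> by (intro mult_mono) auto
    qed
    moreover have "(\<Sum>k\<in>UNIV - {k0}. h * infnorm z) = real ?m * (h * infnorm z) - h * infnorm z"
      by (simp add: card_Diff_singleton of_nat_diff algebra_simps)
    ultimately have "\<bar>(b - c) $ k0 * z $ k0\<bar> < ?m * h * infnorm z"
      using small by (simp add: mult.assoc)
    then have "\<bar>(b - c) $ k0\<bar> < ?m * h"
      using Z by (simp add: abs_mult k0)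
    then have "\<bar>2 * h * u k0 - 2 * h * v k0\<bar> < ?m * h + h"
      using bk[of k0] ck[of k0] by (auto simp: abs_less_iff)
    then have "h * \<bar>2 * (real (u k0) - real (v k0))\<bar> < h * (?m + 1)"
    proof -
      have "2 * h * u k0 - 2 * h * v k0 = h * (2 * (real (u k0) - real (v k0)))"
        by (simp add: algebra_simps)
      moreover have "?m * h + h = h * (?m + 1)" by (simp add: algebra_simps)
      ultimately show ?thesis
        using \<open>\<bar>2 * h * u k0 - 2 * h * v k0\<bar> < ?m * h + h\<close> \<open>0 < h\<close> by (metis abs_mult abs_of_pos)
    qed
    then have "\<bar>2 * (real (u k0) - real (v k0))\<bar> < ?m + 1"
      using \<open>0 < h\<close> by simp
    then have "\<bar>real (u k0) - real (v k0)\<bar> < real (?m + 1)"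
      by (rule le_less_trans[rotated]) (simp add: abs_mult)
    then have "real_of_int \<bar>int (u k0) - int (v k0)\<bar> < real_of_int (int (?m + 1))" by simp
    then have lt: "\<bar>int (u k0) - int (v k0)\<bar> < int (?m + 1)" by (simp only: of_int_less_iff)
    have "int (?m + 1) dvd int (u k0) - int (v k0)"
      using mod by (metis mod_eq_dvd_iff zmod_int)
    then have "int (u k0) - int (v k0) = 0"
      using lt by (metis dvd_imp_le_int not_less abs_of_nat)
    then have "u k0 = v k0" by simp
    with off show "u = v" by (intro ext) (metis)
  qed
  ultimately show ?thesis
    using card_inj_on_le[of \<phi> ?B T] \<open>finite T\<close> cardT by simp
qed

text \<open>The bounds \<open>d i\<close> are kept apart from the sets: they have to be positive,
  and in the application they bound sets in a product space of which the \<open>F i\<close> are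
  slices.\<close>

definition hit_sum :: "real \<Rightarrow> (nat \<Rightarrow> real) \<Rightarrow> (nat \<Rightarrow> 'a set) \<Rightarrow> 'a set \<Rightarrow> ennreal" where
  "hit_sum s d F Q = (\<Sum>i. if F i \<inter> Q = {} then 0 else ennreal (d i powr s))"

text \<open>One summand is at most the whole sum, so a cube with small hit sum is met only by sets
  that are small on its own scale.\<close>

lemma diam_le_if_hit:
  assumes "0 < s" "0 < d i" "0 < r" "hit_sum s d F Q \<le> ennreal (r powr s)" "F i \<inter> Q \<noteq> {}"
  shows "d i \<le> r"
proof -
  have "ennreal (d i powr s) \<le> hit_sum s d F Q"
    unfolding hit_sum_def
    using ennreal_le_suminf[of "\<lambda>i. if F i \<inter> Q = {} then 0 else ennreal (d i powr s)" i] assms(5) by simp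
  also note assms(4)
  finally have "d i powr s \<le> r powr s" using assms by (simp add: ennreal_le_iff)
  then show ?thesis using powr_less_mono2[of s r "d i"] assms by (cases "d i \<le> r") auto
qed

text \<open>After exchanging the sums, every index contributes to at most one cell
  \<open>C u\<close>, and then it contributes to \<open>Q\<close> as well.\<close>

lemma sum_hit_sum_le:
  assumes "finite G" and sub: "\<And>u. u \<in> G \<Longrightarrow> C u \<subseteq> Q"
    and once: "\<And>i u v. \<lbrakk>u \<in> G; v \<in> G; F i \<inter> C u \<noteq> {}; F i \<inter> C v \<noteq> {}\<rbrakk> \<Longrightarrow> u = v"
  shows "(\<Sum>u\<in>G. hit_sum s d F (C u)) \<le> hit_sum s d F Q"
proof -
  have "(\<Sum>u\<in>G. hit_sum s d F (C u))
      = (\<Sum>i. \<Sum>u\<in>G. if F i \<inter> C u = {} then 0 else ennreal (d i powr s))"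
    unfolding hit_sum_def by (rule suminf_sum[symmetric]) (rule summableI)
  also have "\<dots> \<le> hit_sum s d F Q"
    unfolding hit_sum_def
  proof (intro suminf_le summableI)
    fix i
    let ?w = "ennreal (d i powr s)"
    show "(\<Sum>u\<in>G. if F i \<inter> C u = {} then 0 else ?w) \<le> (if F i \<inter> Q = {} then 0 else ?w)"
    proof (cases "\<exists>u\<in>G. F i \<inter> C u \<noteq> {}")
      case True
      then obtain u where u: "u \<in> G" "F i \<inter> C u \<noteq> {}" by blast
      have "(\<Sum>v\<in>G. if F i \<inter> C v = {} then 0 else ?w) = (\<Sum>v\<in>G. if v = u then ?w else 0)"
        using once[OF u(1)] u by (intro sum.cong) auto
      also have "\<dots> = ?w" using u \<open>finite G\<close> by simp
      finally show ?thesis using u sub by auto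
    next
      case False
      then show ?thesis by simp
    qed
  qed
  finally show ?thesis .
qed

text \<open>Pigeonhole among the children that meet no strip: by \<open>many\<close> there are more
  than \<open>(2 * M) powr s\<close> of them, and their hit sums add up to at most that of the
  parent. The flag \<open>act\<close> is false on levels where no strip has to be avoided.\<close>

lemma subcube_step:
  fixes a z :: "real ^ 'm" and l s \<gamma> :: real and F :: "nat \<Rightarrow> (real ^ 'm) set"
  assumes l: "0 < l" and M: "0 < M" and s: "0 < s"
    and many: "(2 * real M) powr s < real M ^ CARD('m) - (CARD('m) + 1) * real M ^ (CARD('m) - 1)"
    and d: "\<And>i. 0 < d i" and F: "\<And>i x y. \<lbrakk>x \<in> F i; y \<in> F i\<rbrakk> \<Longrightarrow> dist x y \<le> d i"
    and hit: "hit_sum s d F (cube a l) \<le> ennreal ((l / (4 * real M)) powr s)"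
    and \<gamma>: "0 < \<gamma>" "\<gamma> \<le> 1/8"
    and z: "act \<Longrightarrow> l * CARD('m) * infnorm z \<le> 1/2 \<and> 4 * real M * \<gamma> \<le> l * infnorm z"
  obtains a' where "cube a' (l / (2 * real M)) \<subseteq> cube a l"
    "hit_sum s d F (cube a' (l / (2 * real M))) \<le> ennreal ((l / (2 * real M) / (4 * real M)) powr s)"
    "\<And>b p::int. \<lbrakk>act; b \<in> cube a' (l / (2 * real M))\<rbrakk> \<Longrightarrow> \<gamma> \<le> \<bar>b \<bullet> z - p\<bar>"
proof -
  let ?m = "CARD('m)"
  define B where "B = {u \<in> UNIV \<rightarrow> {..<M}. act \<and> (\<exists>b\<in>subcube a l M u. \<exists>p::int. \<bar>b \<bullet> z - p\<bar> < \<gamma>)}"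
  define G where "G = (UNIV \<rightarrow> {..<M}) - B"
  have finP: "finite ((UNIV::'m set) \<rightarrow> {..<M})"
    unfolding PiE_UNIV_domain[symmetric] by (rule finite_PiE) auto
  have cardP: "card ((UNIV::'m set) \<rightarrow> {..<M}) = M ^ ?m"
    unfolding PiE_UNIV_domain[symmetric] by (subst card_PiE) auto
  have "finite G" using finP by (simp add: G_def)
  have "card B \<le> (?m + 1) * M ^ (?m - 1)"
  proof (cases act)
    case True
    then show ?thesis unfolding B_def using card_bad_subcubes_le[OF l M \<gamma>, of z a] z by simp
  qed (simp add: B_def)
  then have cB: "real (card B) \<le> (?m + 1) * real M ^ (?m - 1)"
    by (metis of_nat_le_iff of_nat_mult of_nat_power)
  have "card G = M ^ ?m - card B"
    unfolding G_def cardP[symmetric] by (intro card_Diff_subset finite_subset[OF _ finP]) (auto simp: B_def)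
  then have "real M ^ ?m - card B \<le> card G" by (simp add: of_nat_diff_real)
  then have cG: "(2 * real M) powr s < card G" using many cB by linarith
  \<comment> \<open>The threshold required of a child. That of the parent is
    \<open>(2 * M) powr s\<close> times as large, hence less than \<open>card G\<close>
    times.\<close>
  define \<theta> where "\<theta> = (l / (2 * real M) / (4 * real M)) powr s"
  have "0 < \<theta>" using l M by (simp add: \<theta>_def)
  have big: "(l / (4 * real M)) powr s = (2 * real M) powr s * \<theta>"
    using l M by (simp add: \<theta>_def flip: powr_mult)
  have "(\<Sum>u\<in>G. hit_sum s d F (subcube a l M u)) \<le> hit_sum s d F (cube a l)"
  proof (rule sum_hit_sum_le[OF \<open>finite G\<close>])
    show sub: "subcube a l M u \<subseteq> cube a l" if "u \<in> G" for u
      using that l M by (intro subcube_subset) (auto simp: G_def)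
    fix i u v assume uv: "u \<in> G" "v \<in> G" "F i \<inter> subcube a l M u \<noteq> {}" "F i \<inter> subcube a l M v \<noteq> {}"
    then obtain x y where xy: "x \<in> F i" "x \<in> subcube a l M u" "y \<in> F i" "y \<in> subcube a l M v" by blast
    then have "F i \<inter> cube a l \<noteq> {}" using sub[OF uv(1)] by blast
    \<comment> \<open>The threshold is half of the gap \<open>l / (2 * M)\<close>, so a set that
      hits the parent is too small to meet two children.\<close>
    then have "d i \<le> l / (4 * real M)" using diam_le_if_hit[OF s d _ hit] l M by simp
    also have "\<dots> < l / (2 * real M)" using l M by (simp add: field_simps)
    finally have "dist x y < l / (2 * real M)" using F[OF xy(1,3)] by simp
    then show "u = v" using dist_subcubes_ge[OF l M xy(2,4)] by force
  qed
  then have le: "(\<Sum>u\<in>G. hit_sum s d F (subcube a l M u)) \<le> ennreal ((2 * real M) powr s * \<theta>)"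
    using hit by (simp add: big)
  have "\<exists>u\<in>G. hit_sum s d F (subcube a l M u) \<le> ennreal \<theta>"
  proof (rule ccontr)
    assume "\<not> ?thesis"
    then have "(\<Sum>u\<in>G. ennreal \<theta>) \<le> (\<Sum>u\<in>G. hit_sum s d F (subcube a l M u))"
      by (intro sum_mono) (auto simp: not_le intro: less_imp_le)
    then have "ennreal (card G * \<theta>) \<le> ennreal ((2 * real M) powr s * \<theta>)"
      using le by (simp add: ennreal_mult \<open>0 < \<theta>\<close> less_imp_le ennreal_of_nat_eq_real_of_nat)
    then have "card G * \<theta> \<le> (2 * real M) powr s * \<theta>"
      using \<open>0 < \<theta>\<close> by (simp add: ennreal_le_iff)
    then show False using cG \<open>0 < \<theta>\<close> by simp
  qed
  then obtain u where u: "u \<in> G" "hit_sum s d F (subcube a l M u) \<le> ennreal \<theta>" by blast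
  show ?thesis
  proof (rule that)
    show "subcube a l M u \<subseteq> cube a l"
      using u l M by (intro subcube_subset) (auto simp: G_def)
    show "hit_sum s d F (subcube a l M u) \<le> ennreal ((l / (2 * real M) / (4 * real M)) powr s)"
      using u by (simp add: \<theta>_def)
    show "\<gamma> \<le> \<bar>b \<bullet> z - p\<bar>" if "act" "b \<in> subcube a l M u" for b and p :: int
      using u(1) that by (auto simp: G_def B_def not_less)
  qed
qed

text \<open>Iterating the step gives nested cubes, and a common point avoids all strips of the
  levels in \<open>J\<close>. If it lay in \<open>F i\<close>, then \<open>F i\<close> would hit
  every cube, and \<open>d i\<close> would be bounded by a null sequence.\<close>

lemma exists_avoiding_point:
  fixes a :: "real ^ 'm" and l s \<gamma> :: real and z :: "nat \<Rightarrow> real ^ 'm" and F :: "nat \<Rightarrow> (real ^ 'm) set"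
  assumes l: "0 < l" and M: "0 < M" and s: "0 < s"
    and many: "(2 * real M) powr s < real M ^ CARD('m) - (CARD('m) + 1) * real M ^ (CARD('m) - 1)"
    and d: "\<And>i. 0 < d i" and F: "\<And>i x y. \<lbrakk>x \<in> F i; y \<in> F i\<rbrakk> \<Longrightarrow> dist x y \<le> d i"
    and hit: "hit_sum s d F (cube a l) \<le> ennreal ((l / (4 * real M)) powr s)"
    and \<gamma>: "0 < \<gamma>" "\<gamma> \<le> 1/8"
    and z: "\<And>j. j \<in> J \<Longrightarrow> l / (2 * real M) ^ j * CARD('m) * infnorm (z j) \<le> 1/2
              \<and> 4 * real M * \<gamma> \<le> l / (2 * real M) ^ j * infnorm (z j)"
  obtains b where "b \<in> cube a l" "b \<notin> (\<Union>i. F i)" "\<And>j p::int. j \<in> J \<Longrightarrow> \<gamma> \<le> \<bar>b \<bullet> z j - p\<bar>"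
proof -
  define L where "L j = l / (2 * real M) ^ j" for j
  have L: "0 < L j" "L (Suc j) = L j / (2 * real M)" for j
    using l M by (simp_all add: L_def)
  \<comment> \<open>The first conjunct is the invariant, with the root pinned to \<open>a\<close>;
    the second relates consecutive cubes.\<close>
  have "\<exists>c. \<forall>j. (hit_sum s d F (cube (c j) (L j)) \<le> ennreal ((L j / (4 * real M)) powr s) \<and> (j = 0 \<longrightarrow> c j = a)) \<and>
      (cube (c (Suc j)) (L (Suc j)) \<subseteq> cube (c j) (L j) \<and>
       (j \<in> J \<longrightarrow> (\<forall>b\<in>cube (c (Suc j)) (L (Suc j)). \<forall>p::int. \<gamma> \<le> \<bar>b \<bullet> z j - p\<bar>)))"
  proof (rule dependent_nat_choice)
    show "\<exists>x. hit_sum s d F (cube x (L 0)) \<le> ennreal ((L 0 / (4 * real M)) powr s) \<and> (0 = 0 \<longrightarrow> x = a)"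
      using hit by (simp add: L_def)
  next
    fix x j
    assume x: "hit_sum s d F (cube x (L j)) \<le> ennreal ((L j / (4 * real M)) powr s) \<and> (j = 0 \<longrightarrow> x = a)"
    obtain a' where "cube a' (L j / (2 * real M)) \<subseteq> cube x (L j)"
      "hit_sum s d F (cube a' (L j / (2 * real M))) \<le> ennreal ((L j / (2 * real M) / (4 * real M)) powr s)"
      "\<And>b p::int. \<lbrakk>j \<in> J; b \<in> cube a' (L j / (2 * real M))\<rbrakk> \<Longrightarrow> \<gamma> \<le> \<bar>b \<bullet> z j - p\<bar>"
      by (rule subcube_step[OF L(1) M s many d F conjunct1[OF x] \<gamma> z[folded L_def, of j]]) auto
    then show "\<exists>y. (hit_sum s d F (cube y (L (Suc j))) \<le> ennreal ((L (Suc j) / (4 * real M)) powr s) \<and> (Suc j = 0 \<longrightarrow> y = a)) \<and>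
      (cube y (L (Suc j)) \<subseteq> cube x (L j) \<and>
       (j \<in> J \<longrightarrow> (\<forall>b\<in>cube y (L (Suc j)). \<forall>p::int. \<gamma> \<le> \<bar>b \<bullet> z j - p\<bar>)))"
      unfolding L(2) by (intro exI[of _ a']) auto
  qed
  then obtain c where c: "\<And>j. hit_sum s d F (cube (c j) (L j)) \<le> ennreal ((L j / (4 * real M)) powr s)"
    "c 0 = a" "\<And>j. cube (c (Suc j)) (L (Suc j)) \<subseteq> cube (c j) (L j)"
    and cJ: "\<And>j b p. \<lbrakk>j \<in> J; b \<in> cube (c (Suc j)) (L (Suc j))\<rbrakk> \<Longrightarrow> \<gamma> \<le> \<bar>b \<bullet> z j - of_int p\<bar>"
    by metis
  have "(\<Inter>j. cube (c j) (L j)) \<noteq> {}"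
  proof (rule compact_nest)
    show "cube (c n) (L n) \<subseteq> cube (c m) (L m)" if "m \<le> n" for m n
      using lift_Suc_antimono_le[of "\<lambda>j. cube (c j) (L j)", OF c(3) that] .
  qed (use L(1) in \<open>auto intro!: compact_cube cube_nonempty less_imp_le\<close>)
  then obtain b where b: "\<And>j. b \<in> cube (c j) (L j)" by blast
  show ?thesis
  proof (rule that)
    show "b \<in> cube a l" using b[of 0] c(2) by (simp add: L_def)
    show "\<gamma> \<le> \<bar>b \<bullet> z j - p\<bar>" if "j \<in> J" for j and p :: int using cJ[OF that b] .
    show "b \<notin> (\<Union>i. F i)"
    proof
      assume "b \<in> (\<Union>i. F i)"
      then obtain i where "b \<in> F i" by blast
      have "d i \<le> L j / (4 * real M)" for j
        by (rule diam_le_if_hit[OF s d _ c(1)]) (use b[of j] \<open>b \<in> F i\<close> L(1)[of j] M in auto)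
      moreover have "(\<lambda>j. L j / (4 * real M)) \<longlonglongrightarrow> 0 / (4 * real M)"
      proof (intro tendsto_divide tendsto_const)
        have "(\<lambda>j. l * (1 / (2 * real M)) ^ j) \<longlonglongrightarrow> l * 0"
          using M by (intro tendsto_mult tendsto_const LIMSEQ_power_zero) (auto simp: field_simps)
        then show "L \<longlonglongrightarrow> 0" unfolding L_def[abs_def] by (simp add: power_divide)
      qed (use M in auto)
      ultimately have "d i \<le> 0" by (intro LIMSEQ_le_const[where a = "d i"]) auto
      with d[of i] show False by simp
    qed
  qed
qed

section \<open>Dual approximation and transference\<close>

text \<open>Both \<open>(2 * M) powr s\<close> and \<open>(m + 1) * M ^ (m - 1)\<close> are of lower
  order than \<open>M ^ m\<close>; eventually each is at most half of it, the first one
  strictly.\<close>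

lemma eventually_many_subcubes:
  fixes s :: real and m :: nat
  assumes "s < m" "0 < m"
  shows "\<forall>\<^sub>F M in sequentially. (2 * real M) powr s < real M ^ m - (m + 1) * real M ^ (m - 1)"
proof -
  have "((\<lambda>M. real M powr (s - m)) \<longlongrightarrow> 0) sequentially"
    using assms by (intro tendsto_neg_powr filterlim_real_sequentially) auto
  then have "\<forall>\<^sub>F M in sequentially. real M powr (s - m) < 1 / (2 * 2 powr s)"
    by (rule order_tendstoD) simp
  moreover have "\<forall>\<^sub>F M in sequentially. 2 * (m + 1) \<le> M"
    by (rule eventually_ge_at_top)
  ultimately show ?thesis
  proof eventually_elim
    case (elim M)
    then have M: "0 < real M" by simp
    have "(2 * real M) powr s = 2 powr s * (real M powr (s - m) * real M ^ m)"
      using M by (simp add: powr_mult powr_diff flip: powr_realpow)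
    also have "\<dots> < 2 powr s * (1 / (2 * 2 powr s) * real M ^ m)"
      using elim(1) M by (intro mult_strict_left_mono mult_strict_right_mono) auto
    also have "\<dots> = real M ^ m / 2" by simp
    finally have 1: "(2 * real M) powr s < real M ^ m / 2" .
    have "2 * (m + 1) * real M ^ (m - 1) \<le> real M * real M ^ (m - 1)"
      using elim(2) by (intro mult_right_mono) (auto simp flip: of_nat_mult of_nat_add of_nat_Suc)
    also have "\<dots> = real M ^ m" using \<open>0 < m\<close> by (simp flip: power_Suc)
    finally show ?case using 1 by (simp add: algebra_simps)
  qed
qed

text \<open>The maximum-norm distance from the image of \<open>y\<close> under the transpose of
  \<open>A\<close> to the integer lattice.\<close>

definition dual_error :: "real ^ 'n ^ 'm \<Rightarrow> int ^ 'm \<Rightarrow> real" where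
  "dual_error A y = (MAX k. \<bar>(transpose A *v real_vec y) $ k - round ((transpose A *v real_vec y) $ k)\<bar>)"

lemma dual_error_le_iff:
  "dual_error A y \<le> c \<longleftrightarrow>
    (\<forall>k. \<bar>(transpose A *v real_vec y) $ k - round ((transpose A *v real_vec y) $ k)\<bar> \<le> c)"
  unfolding dual_error_def by (subst Max_le_iff) auto

section \<open>Dirichlet's theorem for the transposed system\<close>

lemma frac_diff_lt:
  fixes x y :: real
  assumes "0 < K" "\<lfloor>K * frac x\<rfloor> = \<lfloor>K * frac y\<rfloor>"
  shows "\<bar>frac x - frac y\<bar> \<le> 1 / K"
proof -
  have "\<bar>K * frac x - K * frac y\<bar> \<le> 1" using assms(2) by linarith
  then have "K * \<bar>frac x - frac y\<bar> \<le> 1"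
    using \<open>0 < K\<close> by (metis abs_mult abs_of_pos right_diff_distrib)
  then show ?thesis using \<open>0 < K\<close> by (simp add: field_simps)
qed

text \<open>The vectors with entries from 0 to \<open>Y\<close> are sorted into
  \<open>K ^ CARD('n)\<close> boxes by the fractional parts of their images. Two in the same box
  differ by the vector sought.\<close>

lemma Dirichlet_dual:
  fixes A :: "real ^ 'n ^ 'm" and K Y :: nat
  assumes "0 < K" and pigeons: "K ^ CARD('n) < (Y + 1) ^ CARD('m)"
  obtains y where "y \<noteq> 0" "\<And>i. \<bar>y $ i\<bar> \<le> int Y" "dual_error A y \<le> 1 / K"
proof -
  define w where "w y = transpose A *v real_vec y" for y
  define V where "V = vec_lambda ` PiE (UNIV::'m set) (\<lambda>_. {0..int Y})"
  define H where "H = PiE (UNIV::'n set) (\<lambda>_. {..<K})"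
  define \<phi> where "\<phi> y = (\<lambda>k. nat \<lfloor>K * frac (w y $ k)\<rfloor>)" for y
  have "card V = (Y + 1) ^ CARD('m)"
    unfolding V_def by (subst card_image) (auto simp: card_PiE inj_on_def vec_lambda_inject nat_add_distrib)
  moreover have "card H = K ^ CARD('n)" by (simp add: H_def card_PiE)
  moreover have "\<phi> ` V \<subseteq> H"
  proof -
    have "nat \<lfloor>K * frac (w y $ k)\<rfloor> < K" for y k
    proof -
      have "real K * frac (w y $ k) < real K * 1"
        using \<open>0 < K\<close> by (intro mult_strict_left_mono) (auto simp: frac_lt_1)
      then have "\<lfloor>K * frac (w y $ k)\<rfloor> < int K" by (simp add: floor_less_iff)
      then show ?thesis using \<open>0 < K\<close> by linarith
    qed
    then show ?thesis by (auto simp: H_def \<phi>_def)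
  qed
  moreover have "finite H" by (auto simp: H_def intro!: finite_PiE)
  ultimately have "\<not> inj_on \<phi> V"
    using card_inj_on_le[of \<phi> V H] pigeons by linarith
  then obtain u v where uv: "u \<in> V" "v \<in> V" "u \<noteq> v" "\<phi> u = \<phi> v" by (auto simp: inj_on_def)
  show ?thesis
  proof (rule that)
    show "u - v \<noteq> 0" using uv by simp
    have "0 \<le> u $ i \<and> u $ i \<le> int Y" "0 \<le> v $ i \<and> v $ i \<le> int Y" for i
      using uv(1,2) by (auto simp: V_def PiE_UNIV_domain Pi_iff)
    then show "\<bar>(u - v) $ i\<bar> \<le> int Y" for i
      by (smt (verit) vector_minus_component)
    have "\<bar>w (u - v) $ k - round (w (u - v) $ k)\<bar> \<le> 1 / K" for k
    proof -
      have "real_vec (u - v) = real_vec u - real_vec v"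
        by (simp add: real_vec_def vec_eq_iff)
      then have *: "w (u - v) $ k = w u $ k - w v $ k"
        by (simp add: w_def matrix_vector_mult_diff_distrib)
      have "nat \<lfloor>K * frac (w u $ k)\<rfloor> = nat \<lfloor>K * frac (w v $ k)\<rfloor>"
        using fun_cong[OF uv(4), of k] by (simp add: \<phi>_def)
      then have "\<lfloor>K * frac (w u $ k)\<rfloor> = \<lfloor>K * frac (w v $ k)\<rfloor>"
        by (simp add: eq_nat_nat_iff)
      then have "\<bar>frac (w u $ k) - frac (w v $ k)\<bar> \<le> 1 / K"
        using \<open>0 < K\<close> by (intro frac_diff_lt) auto
      moreover have "frac (w u $ k) - frac (w v $ k)
          = w (u - v) $ k - of_int (\<lfloor>w u $ k\<rfloor> - \<lfloor>w v $ k\<rfloor>)"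
        unfolding * by (simp add: frac_def)
      ultimately show ?thesis
        using round_diff_minimal[of "w (u - v) $ k" "\<lfloor>w u $ k\<rfloor> - \<lfloor>w v $ k\<rfloor>"] by linarith
    qed
    then show "dual_error A (u - v) \<le> 1 / K" by (simp add: dual_error_le_iff w_def)
  qed
qed

text \<open>Keeping the old minimiser as long as possible leaves at most one new vector per level.\<close>

lemma minimisers_with_memory:
  fixes f :: "'a \<Rightarrow> real"
  assumes "\<And>j. finite (B j)" "\<And>j. B j \<noteq> {}" and mono: "\<And>j. B j \<subseteq> B (Suc j)"
  obtains y where "\<And>j::nat. y j \<in> B j" "\<And>j x. x \<in> B j \<Longrightarrow> f (y j) \<le> f x"
    "\<And>j. y (Suc j) = y j \<or> y (Suc j) \<notin> B j"
proof -
  have ex: "\<exists>x\<in>B j. \<forall>x'\<in>B j. f x \<le> f x'" for j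
    using ex_min_if_finite[of "f ` B j"] assms by (auto simp: not_less)
  have "\<exists>y. \<forall>j. (y j \<in> B j \<and> (\<forall>x\<in>B j. f (y j) \<le> f x)) \<and> (y (Suc j) = y j \<or> y (Suc j) \<notin> B j)"
  proof (rule dependent_nat_choice)
    show "\<exists>x. x \<in> B 0 \<and> (\<forall>x'\<in>B 0. f x \<le> f x')" using ex by blast
  next
    fix x j assume x: "x \<in> B j \<and> (\<forall>x'\<in>B j. f x \<le> f x')"
    obtain x' where x': "x' \<in> B (Suc j)" "\<forall>x''\<in>B (Suc j). f x' \<le> f x''" using ex by blast
    show "\<exists>y. (y \<in> B (Suc j) \<and> (\<forall>x'\<in>B (Suc j). f y \<le> f x')) \<and> (y = x \<or> y \<notin> B j)"
    \<comment> \<open>If \<open>x'\<close> already lies in \<open>B j\<close>, the old minimiser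
      \<open>x\<close> does at least as well and is kept.\<close>
    proof (cases "x' \<in> B j")
      case True
      then have "f x \<le> f x'" using x by blast
      then have "\<forall>x''\<in>B (Suc j). f x \<le> f x''" using x' by force
      then show ?thesis using x mono by blast
    next
      case False
      then show ?thesis using x' by blast
    qed
  qed
  then show ?thesis using that by blast
qed

section \<open>Transference and a criterion for bad approximability\<close>

lemma inner_real_vec_Ints: "real_vec u \<bullet> real_vec v \<in> \<int>"
  by (auto simp: real_vec_def inner_vec_def)

text \<open>Split the image of \<open>y\<close> under the transpose into an integer vector
  \<open>z\<close> and an error \<open>e\<close>. The inner product of \<open>A q + b + p\<close>
  with \<open>y\<close>, minus that of \<open>e\<close> with \<open>q\<close>, equals that of
  \<open>b\<close> with \<open>y\<close> up to an integer, so its modulus is at least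
  \<open>\<gamma>\<close>.\<close>

lemma transference:
  fixes A :: "real ^ 'n ^ 'm" and b :: "real ^ 'm" and p y :: "int ^ 'm" and q :: "int ^ 'n"
  assumes Y: "infnorm (real_vec y) \<le> Y" and err: "dual_error A y \<le> \<delta>"
    and far: "\<And>r::int. \<gamma> \<le> \<bar>b \<bullet> real_vec y - r\<bar>"
  shows "\<gamma> \<le> CARD('m) * (infnorm (A *v real_vec q + b + real_vec p) * Y)
             + CARD('n) * (\<delta> * infnorm (real_vec q))"
proof -
  define x where "x = A *v real_vec q + b + real_vec p"
  define w where "w = transpose A *v real_vec y"
  define z :: "int ^ 'n" where "z = (\<chi> k. round (w $ k))"
  define e where "e = w - real_vec z"
  have "(A *v real_vec q) \<bullet> real_vec y = w \<bullet> real_vec q"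
    unfolding w_def transpose_matrix_vector dot_lmul_matrix by (rule inner_commute)
  also have "\<dots> = e \<bullet> real_vec q + real_vec z \<bullet> real_vec q"
    by (simp add: e_def inner_diff_left)
  finally have "x \<bullet> real_vec y - e \<bullet> real_vec q
      = b \<bullet> real_vec y + (real_vec z \<bullet> real_vec q + real_vec p \<bullet> real_vec y)"
    by (simp add: x_def inner_add_left)
  moreover obtain r where "real_vec z \<bullet> real_vec q + real_vec p \<bullet> real_vec y = of_int r"
    using Ints_add[OF inner_real_vec_Ints inner_real_vec_Ints] by (metis Ints_cases)
  ultimately have "\<gamma> \<le> \<bar>x \<bullet> real_vec y - e \<bullet> real_vec q\<bar>"
    using far[of "- r"] by simp
  also have "\<dots> \<le> \<bar>x \<bullet> real_vec y\<bar> + \<bar>e \<bullet> real_vec q\<bar>" by simp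
  also have "\<bar>x \<bullet> real_vec y\<bar> \<le> CARD('m) * (infnorm x * infnorm (real_vec y))"
    by (rule abs_inner_le_cart) (rule component_le_infnorm_cart)
  also have "\<dots> \<le> CARD('m) * (infnorm x * Y)"
    using Y by (intro mult_left_mono) (auto simp: infnorm_pos_le)
  also have "\<bar>e \<bullet> real_vec q\<bar> \<le> CARD('n) * (\<delta> * infnorm (real_vec q))"
  proof (rule abs_inner_le_cart)
    fix k show "\<bar>e $ k\<bar> \<le> \<delta>"
      using err unfolding dual_error_le_iff by (simp add: e_def w_def z_def real_vec_def)
  qed
  finally show ?thesis by (simp add: x_def)
qed

lemma badly_approximableI:
  fixes A :: "real ^ 'n ^ 'm" and b :: "real ^ 'm"
  assumes "0 < c" and
    "\<And>p q. H < infnorm (real_vec q) \<Longrightarrow>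
       c \<le> infnorm (A *v real_vec q + b + real_vec p) ^ CARD('m) * infnorm (real_vec q) ^ CARD('n)"
  shows "badly_approximable (A, b)"
proof -
  let ?F = "filtercomap (\<lambda>(p :: int ^ 'm, q :: int ^ 'n). infnorm (real_vec q)) at_top"
  have "ereal c \<le> Liminf ?F (\<lambda>(p, q). ereal (infnorm (A *v real_vec q + b + real_vec p) ^ CARD('m)
                        * infnorm (real_vec q) ^ CARD('n)))"
    using assms(2) by (intro Liminf_bounded) (auto simp: eventually_filtercomap_at_top_dense intro!: exI[of _ H])
  then show ?thesis
    unfolding badly_approximable_def using \<open>0 < c\<close> by (auto intro: less_le_trans[of 0 "ereal c"])
qed

text \<open>For given \<open>q\<close>, the level \<open>i\<close> is the first at which the error
  term of transference is at most \<open>\<gamma> / 2\<close>. The other term then bounds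
  \<open>x\<close> from below, while minimality of \<open>i\<close> keeps
  \<open>S ^ (CARD('m) * i)\<close> comparable to the norm of \<open>q\<close>.\<close>

lemma badly_approximable_if_dual_far:
  fixes A :: "real ^ 'n ^ 'm" and b :: "real ^ 'm" and y :: "nat \<Rightarrow> int ^ 'm" and S J :: nat
  assumes S: "2 \<le> S" and "0 < \<gamma>"
    and Y: "\<And>j. infnorm (real_vec (y j)) \<le> real S ^ (CARD('n) * (J + j))"
    and err: "\<And>j. dual_error A (y j) \<le> 1 / real S ^ (CARD('m) * (J + j))"
    and far: "\<And>j r::int. \<gamma> \<le> \<bar>b \<bullet> real_vec (y j) - r\<bar>"
  shows "badly_approximable (A, b)"
proof -
  let ?m = "CARD('m)" and ?n = "CARD('n)"
  \<comment> \<open>The factor \<open>S ^ ?m\<close> is lost in passing from level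
    \<open>i - 1\<close>, where the defining inequality of \<open>i\<close> fails, to level
    \<open>i\<close>.\<close>
  define C where "C = real S ^ ?m * (2 * ?n / \<gamma>)"
  have "0 < C" using S \<open>0 < \<gamma>\<close> by (simp add: C_def)
  show ?thesis
  proof (rule badly_approximableI)
    show "0 < (\<gamma> / (2 * ?m)) ^ ?m / C ^ ?n" using \<open>0 < C\<close> \<open>0 < \<gamma>\<close> by simp
    fix p :: "int ^ 'm" and q :: "int ^ 'n"
    define h where "h = infnorm (real_vec q)"
    define x where "x = infnorm (A *v real_vec q + b + real_vec p)"
    \<comment> \<open>This threshold ensures \<open>J < i\<close>, so that \<open>y (i - J)\<close>
      is the vector of level \<open>i\<close>.\<close>
    assume "real S ^ (?m * J) * \<gamma> / (2 * ?n) < infnorm (real_vec q)"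
    then have hJ: "real S ^ (?m * J) < 2 * ?n * h / \<gamma>"
      using \<open>0 < \<gamma>\<close> by (simp add: h_def field_simps)
    have "0 \<le> h" "0 \<le> x" by (simp_all add: h_def x_def infnorm_pos_le)
    obtain i0 where "2 * ?n * h / \<gamma> < (real S ^ ?m) ^ i0"
      using real_arch_pow[of "real S ^ ?m" "2 * ?n * h / \<gamma>"] S by (auto simp: one_less_power)
    then have ex: "\<exists>i. 2 * ?n * h / \<gamma> \<le> real S ^ (?m * i)"
      by (intro exI[of _ i0]) (simp add: power_mult)
    define i where "i = (LEAST i. 2 * ?n * h / \<gamma> \<le> real S ^ (?m * i))"
    have i: "2 * ?n * h / \<gamma> \<le> real S ^ (?m * i)"
      unfolding i_def using ex by (rule LeastI_ex)
    have "J < i"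
    proof (rule ccontr)
      assume "\<not> J < i"
      then have "real S ^ (?m * i) \<le> real S ^ (?m * J)"
        using S by (intro power_increasing) auto
      with i hJ show False by linarith
    qed
    then obtain i' where i': "i = Suc i'" by (cases i) auto
    then have "i' < i" by simp
    then have "\<not> 2 * ?n * h / \<gamma> \<le> real S ^ (?m * i')"
      unfolding i_def by (rule not_less_Least)
    then have "real S ^ ?m * real S ^ (?m * i') \<le> real S ^ ?m * (2 * ?n * h / \<gamma>)"
      using S by (intro mult_left_mono) auto
    then have Ch: "real S ^ (?m * i) \<le> C * h"
      by (simp add: C_def i' power_add)
    define T where "T = real S ^ (?n * i)"
    define D where "D = real S ^ (?m * i)"
    have "0 < D" using S by (simp add: D_def)
    have "J + (i - J) = i" using \<open>J < i\<close> by simp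
    then have "\<gamma> \<le> ?m * (x * T) + ?n * (1 / D * h)"
      using transference[OF Y[of "i - J"] err[of "i - J"] far[of "i - J"], of q p]
      by (simp add: x_def h_def T_def D_def)
    moreover have "?n * (1 / D * h) \<le> \<gamma> / 2"
      using i[folded D_def] \<open>0 < \<gamma>\<close> \<open>0 < D\<close> by (simp add: field_simps)
    ultimately have "\<gamma> / 2 \<le> ?m * (x * T)" by linarith
    then have "\<gamma> / (2 * ?m) \<le> x * T"
      by (simp add: field_simps)
    then have "(\<gamma> / (2 * ?m)) ^ ?m \<le> (x * T) ^ ?m"
      using \<open>0 < \<gamma>\<close> by (intro power_mono) auto
    \<comment> \<open>Both \<open>T ^ ?m\<close> and \<open>D ^ ?n\<close> equal \<open>S\<close> to
      the power \<open>?m * ?n * i\<close>; the two exponents in the hypotheses are balanced for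
      this.\<close>
    also have "\<dots> = x ^ ?m * D ^ ?n"
      by (simp add: power_mult_distrib T_def D_def flip: power_mult) (simp add: mult_ac)
    also have "\<dots> \<le> x ^ ?m * (C * h) ^ ?n"
      using Ch \<open>0 \<le> x\<close> \<open>0 < D\<close> by (intro mult_left_mono power_mono) (auto simp: D_def)
    also have "\<dots> = x ^ ?m * h ^ ?n * C ^ ?n" by (simp add: power_mult_distrib)
    finally show "(\<gamma> / (2 * ?m)) ^ ?m / C ^ ?n \<le> infnorm (A *v real_vec q + b + real_vec p) ^ ?m * infnorm (real_vec q) ^ ?n"
      using \<open>0 < C\<close> by (simp add: x_def h_def pos_divide_le_eq)
  qed
qed

section \<open>Integer boxes, and a badly approximable point in each fibre\<close>

lemma infnorm_real_vec_le:
  assumes "\<And>i. \<bar>y $ i\<bar> \<le> N"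
  shows "infnorm (real_vec y) \<le> of_int N"
proof -
  obtain k where "\<bar>real_vec y $ k\<bar> = infnorm (real_vec y)" by (rule infnorm_attained_cart)
  then have "infnorm (real_vec y) = of_int \<bar>y $ k\<bar>" by (simp add: real_vec_def)
  then show ?thesis using assms[of k] by simp
qed

lemma infnorm_real_vec_gt:
  assumes "N < \<bar>y $ i\<bar>"
  shows "of_int N < infnorm (real_vec y)"
proof -
  have "of_int N < \<bar>real_vec y $ i\<bar>" using assms by (simp add: real_vec_def flip: of_int_abs)
  also have "\<dots> \<le> infnorm (real_vec y)" by (rule component_le_infnorm_cart)
  finally show ?thesis .
qed

lemma finite_int_box: "finite {y :: int ^ 'm. \<forall>i. \<bar>y $ i\<bar> \<le> N}"
proof (rule finite_subset)
  show "{y :: int ^ 'm. \<forall>i. \<bar>y $ i\<bar> \<le> N} \<subseteq> vec_lambda ` PiE UNIV (\<lambda>_. {-N..N})"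
  proof
    fix y :: "int ^ 'm" assume "y \<in> {y. \<forall>i. \<bar>y $ i\<bar> \<le> N}"
    then have "vec_nth y \<in> PiE UNIV (\<lambda>_. {-N..N})"
      by (auto simp: abs_le_iff) (metis minus_le_iff)
    then show "y \<in> vec_lambda ` PiE UNIV (\<lambda>_. {-N..N})"
      by (metis image_eqI vec_nth_inverse)
  qed
qed (auto intro!: finite_PiE)

text \<open>The side at depth \<open>j\<close> is \<open>l / (2 * M) ^ j\<close> and the norm of
  \<open>y j\<close> is at most \<open>(2 * M) ^ (J + j)\<close>, so their product stays bounded;
  whenever \<open>y j\<close> is new, it is also bounded below. These are the inequalities that
  avoiding strips requires.\<close>

lemma exists_bad_translate:
  fixes A :: "real ^ 'n ^ 'm" and b0 :: "real ^ 'm" and l s :: real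
    and F :: "nat \<Rightarrow> (real ^ 'm) set" and S J M :: nat
  assumes S: "2 \<le> S" and SM: "S ^ CARD('n) = 2 * M" and s: "0 < s"
    and many: "(2 * real M) powr s < real M ^ CARD('m) - (CARD('m) + 1) * real M ^ (CARD('m) - 1)"
    and d: "\<And>i. 0 < d i" and F: "\<And>i x y. \<lbrakk>x \<in> F i; y \<in> F i\<rbrakk> \<Longrightarrow> dist x y \<le> d i"
    and l: "l = 1 / (2 * CARD('m) * (2 * real M) ^ J)"
    and hit: "hit_sum s d F (cube b0 l) \<le> ennreal ((l / (4 * real M)) powr s)"
  obtains b where "b \<in> cube b0 l" "b \<notin> (\<Union>i. F i)" "badly_approximable (A, b)"
proof -
  let ?m = "CARD('m)" and ?n = "CARD('n)"
  define N where "N j = S ^ (?n * (J + j))" for j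
  have N: "real (N j) = (2 * real M) ^ (J + j)" for j
    by (simp add: N_def power_mult SM)
  have "0 < M" using SM S by (metis gr0I mult_0_right not_numeral_le_zero power_not_zero)
  have "0 < l" using \<open>0 < M\<close> by (simp add: l)
  define B where "B j = {y :: int ^ 'm. y \<noteq> 0 \<and> (\<forall>i. \<bar>y $ i\<bar> \<le> int (N j))}" for j
  have short: "\<exists>y\<in>B j. dual_error A y \<le> 1 / real S ^ (?m * (J + j))" for j
  proof -
    have "(S ^ (?m * (J + j))) ^ ?n = N j ^ ?m"
      by (simp add: N_def mult_ac flip: power_mult)
    also have "\<dots> < (N j + 1) ^ ?m" by (intro power_strict_mono) auto
    finally have lt: "(S ^ (?m * (J + j))) ^ ?n < (N j + 1) ^ ?m" .
    have pos: "0 < S ^ (?m * (J + j))" using S by simp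
    obtain y where "y \<noteq> 0" "\<And>i. \<bar>y $ i\<bar> \<le> int (N j)"
        "dual_error A y \<le> 1 / real (S ^ (?m * (J + j)))"
      by (rule Dirichlet_dual[where A = A, OF pos lt]) (rule that)
    then show ?thesis by (auto simp: B_def intro!: bexI[of _ y])
  qed
  have "finite (B j)" for j
    unfolding B_def by (rule finite_subset[OF _ finite_int_box[of "int (N j)"]]) auto
  moreover have "B j \<noteq> {}" for j using short by blast
  moreover have "B j \<subseteq> B (Suc j)" for j
  proof -
    have "N j \<le> N (Suc j)" unfolding N_def using S by (intro power_increasing) auto
    then show ?thesis by (auto simp: B_def intro: order_trans)
  qed
  ultimately obtain y where yB: "\<And>j. y j \<in> B j"
    and ymin: "\<And>j x. x \<in> B j \<Longrightarrow> dual_error A (y j) \<le> dual_error A x"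
    and ynew: "\<And>j. y (Suc j) = y j \<or> y (Suc j) \<notin> B j"
    by (rule minimisers_with_memory[where f = "dual_error A"]) (rule that)
  define z where "z j = real_vec (y j)" for j
  have zle: "infnorm (z j) \<le> (2 * real M) ^ (J + j)" for j
    using yB[of j] infnorm_real_vec_le[of "y j" "int (N j)"] by (simp add: B_def z_def N)
  \<comment> \<open>The first bound serves level 0, where only \<open>1 \<le> infnorm (z 0)\<close>
    is known. The second serves later new vectors, which exceed the previous radius and so lose one
    factor \<open>2 * M\<close>.\<close>
  define \<kappa> where "\<kappa> = min (1 / (2 * ?m * (2 * real M) ^ J)) (1 / (2 * ?m * (2 * real M)))"
  \<comment> \<open>Chosen so that \<open>4 * M * \<gamma> = \<kappa>\<close>.\<close>
  define \<gamma> where "\<gamma> = \<kappa> / (4 * real M)"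
  have "0 < \<kappa>" using \<open>0 < M\<close> by (simp add: \<kappa>_def)
  then have "0 < \<gamma>" using \<open>0 < M\<close> by (simp add: \<gamma>_def)
  have "1 \<le> real ?m" "1 \<le> real M" using \<open>0 < M\<close> by (simp_all add: Suc_le_eq)
  have "\<gamma> \<le> 1 / 8"
  proof -
    have "\<kappa> \<le> 1 / (2 * ?m * (2 * real M))" by (simp add: \<kappa>_def)
    also have "\<dots> \<le> 1 / (2 * 1 * (2 * 1))"
      using \<open>1 \<le> real ?m\<close> \<open>1 \<le> real M\<close> by (intro divide_left_mono mult_mono) auto
    finally have "\<kappa> \<le> 1 / 2" by simp
    then have "\<kappa> / (4 * real M) \<le> (1 / 2) / (4 * 1)"
      using \<open>1 \<le> real M\<close> \<open>0 < \<kappa>\<close> by (intro frac_le) auto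
    then show ?thesis by (simp add: \<gamma>_def)
  qed
  \<comment> \<open>The levels with a new vector; level 0 is listed separately because
    \<open>j - 1\<close> is truncated there.\<close>
  define D where "D = {j. j = 0 \<or> y j \<noteq> y (j - 1)}"
  have zD: "l / (2 * real M) ^ j * ?m * infnorm (z j) \<le> 1/2 \<and>
      4 * real M * \<gamma> \<le> l / (2 * real M) ^ j * infnorm (z j)" if "j \<in> D" for j
  proof
    have "l / (2 * real M) ^ j * ?m * infnorm (z j) \<le> l / (2 * real M) ^ j * ?m * (2 * real M) ^ (J + j)"
      using zle \<open>0 < l\<close> by (intro mult_left_mono) auto
    also have "\<dots> = 1 / 2" using \<open>0 < M\<close> by (simp add: l power_add)
    finally show "l / (2 * real M) ^ j * ?m * infnorm (z j) \<le> 1/2" .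
    have "\<kappa> \<le> l / (2 * real M) ^ j * infnorm (z j)"
    proof (cases j)
      case 0
      have "y 0 \<noteq> 0" using yB[of 0] by (simp add: B_def)
      then obtain i where "y 0 $ i \<noteq> 0" by (auto simp: vec_eq_iff)
      then have "0 < \<bar>y 0 $ i\<bar>" by simp
      obtain k where k: "\<bar>z 0 $ k\<bar> = infnorm (z 0)" by (rule infnorm_attained_cart)
      have "0 < infnorm (z 0)" using infnorm_real_vec_gt[OF \<open>0 < \<bar>y 0 $ i\<bar>\<close>] by (simp add: z_def)
      then have "1 \<le> infnorm (z 0)" unfolding k[symmetric] by (simp add: z_def real_vec_def flip: of_int_abs)
      then have "l * 1 \<le> l * infnorm (z 0)" using \<open>0 < l\<close> by (intro mult_left_mono) auto
      then show ?thesis using 0 by (simp add: \<kappa>_def l min_le_iff_disj)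
    next
      case (Suc i)
      then have "y j \<notin> B i" using that ynew[of i] by (auto simp: D_def)
      moreover have "y j \<noteq> 0" using yB[of j] by (simp add: B_def)
      ultimately obtain k where "int (N i) < \<bar>y j $ k\<bar>" by (auto simp: B_def not_le)
      then have "(2 * real M) ^ (J + i) \<le> infnorm (z j)"
        using infnorm_real_vec_gt[of "int (N i)" "y j" k] by (simp add: z_def N)
      then have "l / (2 * real M) ^ j * (2 * real M) ^ (J + i) \<le> l / (2 * real M) ^ j * infnorm (z j)"
        using \<open>0 < l\<close> by (intro mult_left_mono) auto
      moreover have "l / (2 * real M) ^ j * (2 * real M) ^ (J + i) = 1 / (2 * ?m * (2 * real M))"
        using \<open>0 < M\<close> by (simp add: Suc l power_add)
      ultimately show ?thesis by (simp add: \<kappa>_def min_le_iff_disj)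
    qed
    then show "4 * real M * \<gamma> \<le> l / (2 * real M) ^ j * infnorm (z j)"
      using \<open>0 < M\<close> by (simp add: \<gamma>_def)
  qed
  obtain b where b: "b \<in> cube b0 l" "b \<notin> (\<Union>i. F i)"
    and bD: "\<And>j p::int. j \<in> D \<Longrightarrow> \<gamma> \<le> \<bar>b \<bullet> z j - p\<bar>"
    using exists_avoiding_point[OF \<open>0 < l\<close> \<open>0 < M\<close> s many d F hit \<open>0 < \<gamma>\<close> \<open>\<gamma> \<le> 1 / 8\<close> zD] by blast
  \<comment> \<open>Outside \<open>D\<close> the vector repeats its predecessor, whose strip has
    been avoided already.\<close>
  have far: "\<gamma> \<le> \<bar>b \<bullet> z j - of_int p\<bar>" for j p
  proof (induction j)
    case 0
    show ?case by (rule bD) (simp add: D_def)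
  next
    case (Suc j)
    then show ?case using bD[of "Suc j" p] by (cases "Suc j \<in> D") (auto simp: D_def z_def)
  qed
  have "badly_approximable (A, b)"
  proof (rule badly_approximable_if_dual_far[OF S \<open>0 < \<gamma>\<close>])
    show "infnorm (real_vec (y j)) \<le> real S ^ (?n * (J + j))" for j
      using zle[of j] unfolding z_def N[symmetric] by (simp add: N_def)
    show "dual_error A (y j) \<le> 1 / real S ^ (?m * (J + j))" for j
      using short[of j] ymin order_trans by blast
    show "\<gamma> \<le> \<bar>b \<bullet> real_vec (y j) - of_int r\<bar>" for j r
      using far by (simp add: z_def)
  qed
  with b that show ?thesis by blast
qed

section \<open>Slicing a cover\<close>

text \<open>Adding \<open>\<epsilon> / 2 ^ (i + 1)\<close> to each \<open>t\<close>-th power makes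
  the bounds positive even for points and empty sets, at a total cost of
  \<open>\<epsilon>\<close>.\<close>

lemma positive_diameter_bounds:
  fixes U :: "nat \<Rightarrow> 'a::metric_space set" and t \<epsilon> :: real
  assumes "0 < t" "0 < \<epsilon>" and U: "\<And>i. bounded (U i)"
    and sum: "(\<Sum>i. ennreal (diameter (U i) powr t)) < ennreal \<epsilon>"
  obtains d where "\<And>i. 0 < d i" "\<And>i. diameter (U i) \<le> d i"
    "(\<Sum>i. ennreal (d i powr t)) \<le> ennreal (2 * \<epsilon>)"
proof -
  define d where "d i = (diameter (U i) powr t + \<epsilon> * (1/2) ^ Suc i) powr (1 / t)" for i
  have pos: "0 < diameter (U i) powr t + \<epsilon> * (1/2) ^ Suc i" for i
    using \<open>0 < \<epsilon>\<close> by (intro add_nonneg_pos) auto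
  have dt: "d i powr t = diameter (U i) powr t + \<epsilon> * (1/2) ^ Suc i" for i
    using \<open>0 < t\<close> pos[of i] by (simp add: d_def powr_powr)
  show ?thesis
  proof (rule that)
    show "0 < d i" for i using pos[of i] by (simp add: d_def)
    show "diameter (U i) \<le> d i" for i
    proof -
      have "diameter (U i) = (diameter (U i) powr t) powr (1 / t)"
        using \<open>0 < t\<close> diameter_ge_0[OF U, of i] by (simp add: powr_powr)
      also have "\<dots> \<le> d i"
        unfolding d_def using \<open>0 < t\<close> \<open>0 < \<epsilon>\<close> by (intro powr_mono2) auto
      finally show ?thesis .
    qed
    have "(\<Sum>i. ennreal (d i powr t))
        = (\<Sum>i. ennreal (diameter (U i) powr t) + ennreal (\<epsilon> * (1/2) ^ Suc i))"
      unfolding dt using \<open>0 < \<epsilon>\<close> by (intro suminf_cong ennreal_plus) auto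
    also have "\<dots> = (\<Sum>i. ennreal (diameter (U i) powr t)) + (\<Sum>i. ennreal (\<epsilon> * (1/2) ^ Suc i))"
      by (rule suminf_add[symmetric]) (rule summableI)+
    also have "(\<Sum>i. ennreal (\<epsilon> * (1/2) ^ Suc i)) = ennreal \<epsilon>"
      using sums_mult[OF power_half_series, of \<epsilon>] \<open>0 < \<epsilon>\<close> by (intro suminf_ennreal_eq) auto
    also have "(\<Sum>i. ennreal (diameter (U i) powr t)) + ennreal \<epsilon> \<le> ennreal \<epsilon> + ennreal \<epsilon>"
      using sum by (intro add_right_mono) auto
    also have "\<dots> = ennreal (2 * \<epsilon>)" using \<open>0 < \<epsilon>\<close> by (simp flip: ennreal_plus)
    finally show "(\<Sum>i. ennreal (d i powr t)) \<le> ennreal (2 * \<epsilon>)" .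
  qed
qed

text \<open>Integration over \<open>A\<close> turns each \<open>d i powr s\<close> into
  \<open>v * d i powr (N + s)\<close>, where \<open>N\<close> is the dimension and \<open>v\<close>
  the volume of the unit ball. Were the sum above \<open>\<eta>\<close> on the whole ball, its
  integral would be at least \<open>\<eta> * v * r ^ N\<close>, which exceeds
  \<open>v * \<epsilon>\<close>.\<close>

lemma exists_small_fibre:
  fixes c :: "nat \<Rightarrow> 'a::euclidean_space" and d :: "nat \<Rightarrow> real" and s r \<eta> \<epsilon> :: real
  assumes d: "\<And>i. 0 < d i" and "0 < r" "0 < \<eta>"
    and sum: "(\<Sum>i. ennreal (d i powr (DIM('a) + s))) \<le> ennreal \<epsilon>"
    and \<epsilon>: "\<epsilon> < \<eta> * r ^ DIM('a)"
  shows "\<exists>A\<in>ball A0 r. (\<Sum>i. ennreal (d i powr s) * indicator (cball (c i) (d i)) A) \<le> ennreal \<eta>"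
proof (rule ccontr)
  let ?N = "DIM('a)"
  let ?f = "\<lambda>A. \<Sum>i. ennreal (d i powr s) * indicator (cball (c i) (d i)) A"
  define v where "v = unit_ball_vol ?N"
  have "0 < v" by (simp add: v_def)
  assume "\<not> ?thesis"
  then have large: "ennreal \<eta> \<le> ?f A" if "A \<in> ball A0 r" for A
    using that by (meson linear)
  have "ennreal (\<eta> * (v * r ^ ?N)) = (\<integral>\<^sup>+A. ennreal \<eta> * indicator (ball A0 r) A \<partial>lborel)"
    using \<open>0 < r\<close> \<open>0 < \<eta>\<close> \<open>0 < v\<close>
    by (subst nn_integral_cmult_indicator) (auto simp: emeasure_ball v_def ennreal_mult)
  also have "\<dots> \<le> (\<integral>\<^sup>+A. ?f A \<partial>lborel)"
  proof (rule nn_integral_mono)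
    show "ennreal \<eta> * indicator (ball A0 r) A \<le> ?f A" for A
      by (cases "A \<in> ball A0 r") (simp_all only: indicator_simps mult_1_right mult_zero_right large zero_le not_False_eq_True)
  qed
  also have "\<dots> = (\<Sum>i. \<integral>\<^sup>+A. ennreal (d i powr s) * indicator (cball (c i) (d i)) A \<partial>lborel)"
  proof (rule nn_integral_suminf)
    show "(\<lambda>A. ennreal (d i powr s) * indicator (cball (c i) (d i)) A) \<in> borel_measurable lborel" for i
      by (intro borel_measurable_times_ennreal borel_measurable_const borel_measurable_indicator) simp
  qed
  also have "\<dots> = (\<Sum>i. ennreal v * ennreal (d i powr (?N + s)))"
  proof (rule suminf_cong)
    fix i
    have "(\<integral>\<^sup>+A. ennreal (d i powr s) * indicator (cball (c i) (d i)) A \<partial>lborel)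
        = ennreal (d i powr s) * ennreal (v * d i ^ ?N)"
      using d[of i] by (subst nn_integral_cmult_indicator) (auto simp: emeasure_cball v_def)
    also have "\<dots> = ennreal v * ennreal (d i powr (?N + s))"
      using d[of i] \<open>0 < v\<close> by (simp add: powr_add powr_realpow mult_ac flip: ennreal_mult)
    finally show "(\<integral>\<^sup>+A. ennreal (d i powr s) * indicator (cball (c i) (d i)) A \<partial>lborel)
        = ennreal v * ennreal (d i powr (?N + s))" .
  qed
  also have "\<dots> = ennreal v * (\<Sum>i. ennreal (d i powr (?N + s)))"
    by (rule ennreal_suminf_cmult)
  also have "\<dots> \<le> ennreal v * ennreal \<epsilon>"
    using sum by (rule mult_left_mono) simp
  also have "\<dots> = ennreal (v * \<epsilon>)" using \<open>0 < v\<close> by (simp add: ennreal_mult')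
  finally have "ennreal (\<eta> * (v * r ^ ?N)) \<le> ennreal (v * \<epsilon>)" .
  moreover have "v * \<epsilon> < \<eta> * (v * r ^ ?N)"
    using \<epsilon> \<open>0 < v\<close> by (simp add: mult.left_commute)
  moreover have "0 < \<eta> * (v * r ^ ?N)" using \<open>0 < v\<close> \<open>0 < \<eta>\<close> \<open>0 < r\<close> by simp
  ultimately show False by (simp add: ennreal_le_iff2)
qed

text \<open>If a smaller exponent \<open>s'\<close> gave measure zero, a cover with small sum could
  be sliced over a well chosen \<open>A\<close>, and the fibre over \<open>A\<close> would contain a
  badly approximable point missed by all slices.\<close>

lemma hausdorff_dim_BA_affine_ge:
  fixes W :: "((real ^ 'n ^ 'm) \<times> (real ^ 'm)) set"
  assumes "open W" "W \<noteq> {}"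
  shows "ereal (CARD('m) * CARD('n) + CARD('m)) \<le> hausdorff_dim (W \<inter> BA_affine)"
  unfolding hausdorff_dim_def
proof (rule INF_greatest, rule ccontr)
  let ?m = "CARD('m)" and ?n = "CARD('n)"
  have dimA: "DIM(real ^ 'n ^ 'm) = ?m * ?n" by simp
  fix s' assume "s' \<in> {s. 0 < s \<and> hausdorff_measure s (W \<inter> BA_affine) = 0}"
    and "\<not> ereal (?m * ?n + ?m) \<le> ereal s'"
  then have "0 < s'" and null: "hausdorff_measure s' (W \<inter> BA_affine) = 0" and s': "s' < ?m * ?n + ?m"
    by (auto simp: not_le)
  \<comment> \<open>The fibre exponent must lie strictly between 0 and \<open>?m\<close>; the value
    1/2 secures positivity when \<open>s'\<close> is small, and \<open>s' \<le> t\<close> still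
    holds.\<close>
  define s where "s = max (s' - ?m * ?n) (1/2)"
  define t where "t = ?m * ?n + s"
  have "1 \<le> real ?m" by (simp add: Suc_le_eq)
  then have s: "0 < s" "s < ?m"
    unfolding s_def less_max_iff_disj max_less_iff_conj using s' by linarith+
  have t: "0 < t" "s' \<le> t" using s by (auto simp: t_def s_def add_nonneg_pos)
  obtain A0 b0 where "(A0, b0) \<in> W" using \<open>W \<noteq> {}\<close> by auto
  then obtain \<A> \<B> where AB: "open \<A>" "open \<B>" "A0 \<in> \<A>" "b0 \<in> \<B>" "\<A> \<times> \<B> \<subseteq> W"
    using \<open>open W\<close> by (auto elim!: open_prod_elim)
  obtain r where r: "0 < r" "ball A0 r \<subseteq> \<A>" using AB by (meson open_contains_ball)
  obtain r' where r': "0 < r'" "ball b0 r' \<subseteq> \<B>" using AB by (meson open_contains_ball)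
  obtain M0 where M0: "\<And>M. M0 \<le> M \<Longrightarrow>
      (2 * real M) powr s < real M ^ ?m - (?m + 1) * real M ^ (?m - 1)"
    using eventually_many_subcubes[OF s(2) zero_less_card_finite] by (auto simp: eventually_sequentially)
  \<comment> \<open>An even base makes half of \<open>S ^ ?n\<close> an integer, and the factor 2
    ensures \<open>M0 \<le> M\<close>.\<close>
  define S where "S = 2 * max 1 M0"
  define M where "M = S ^ ?n div 2"
  have "2 \<le> S" by (simp add: S_def)
  have "even (S ^ ?n)" by (simp add: S_def)
  then have SM: "S ^ ?n = 2 * M" by (simp add: M_def)
  have "S \<le> 2 * M" using \<open>2 \<le> S\<close> self_le_power[of S ?n] by (simp flip: SM)
  then have "0 < M" "M0 \<le> M" by (auto simp: S_def)
  note many = M0[OF \<open>M0 \<le> M\<close>]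
  obtain J where J: "1 / r' < (2 * real M) ^ J"
    using real_arch_pow[of "2 * real M" "1 / r'"] \<open>0 < M\<close> by (auto simp: Suc_le_eq)
  define l where "l = 1 / (2 * ?m * (2 * real M) ^ J)"
  have "0 < l" using \<open>0 < M\<close> by (simp add: l_def)
  have "cube b0 l \<subseteq> \<B>"
  proof
    fix x assume "x \<in> cube b0 l"
    then have "b0 $ k \<le> x $ k \<and> x $ k \<le> b0 $ k + l" for k by (simp add: cube_def)
    then have "\<bar>(b0 - x) $ k\<bar> \<le> l" for k
      unfolding vector_minus_component abs_le_iff by (smt (verit))
    then have "norm (b0 - x) \<le> (\<Sum>k\<in>(UNIV::'m set). l)"
      by (intro order_trans[OF norm_le_l1_cart sum_mono])
    also have "\<dots> = 1 / 2 * (1 / (2 * real M) ^ J)" by (simp add: l_def)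
    also have "\<dots> \<le> 1 / (2 * real M) ^ J"
      using \<open>0 < M\<close> by (intro mult_left_le_one_le) auto
    also have "\<dots> < r'" using J r' \<open>0 < M\<close> by (simp add: field_simps)
    finally show "x \<in> \<B>" using r' by (auto simp: dist_norm)
  qed
  define \<eta> where "\<eta> = (l / (4 * real M)) powr s"
  have "0 < \<eta>" using \<open>0 < l\<close> \<open>0 < M\<close> by (simp add: \<eta>_def)
  \<comment> \<open>The bound 1 keeps all diameters at most 1, so that the sum for \<open>t\<close>
    is at most that for \<open>s'\<close>. The quarter leaves room for the later doubling.\<close>
  define \<epsilon> where "\<epsilon> = min 1 (\<eta> * r ^ (?m * ?n) / 4)"
  have \<epsilon>: "0 < \<epsilon>" "\<epsilon> \<le> 1" "2 * \<epsilon> < \<eta> * r ^ (?m * ?n)"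
  proof -
    have "0 < \<eta> * r ^ (?m * ?n)" using \<open>0 < \<eta>\<close> r by simp
    then show "0 < \<epsilon>" "\<epsilon> \<le> 1" "2 * \<epsilon> < \<eta> * r ^ (?m * ?n)" by (auto simp: \<epsilon>_def min_def)
  qed
  obtain U :: "nat \<Rightarrow> _" where cover: "W \<inter> BA_affine \<subseteq> (\<Union>i. U i)" and U: "\<And>i. bounded (U i)"
    and sU: "(\<Sum>i. ennreal (diameter (U i) powr s')) < ennreal \<epsilon>"
    using null \<epsilon>(1) unfolding hausdorff_measure_eq_0_iff[OF \<open>0 < s'\<close>] by metis
  have "(\<Sum>i. ennreal (diameter (U i) powr t)) \<le> (\<Sum>i. ennreal (diameter (U i) powr s'))"
  proof (intro suminf_le summableI ennreal_leI)
    fix i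
    have "ennreal (diameter (U i) powr s') < ennreal \<epsilon>"
      using ennreal_le_suminf[of "\<lambda>i. ennreal (diameter (U i) powr s')" i] sU by (rule le_less_trans)
    then have "diameter (U i) powr s' < 1 powr s'" using \<epsilon> by (simp add: ennreal_less_iff)
    then have "diameter (U i) \<le> 1"
      using powr_less_mono2[OF \<open>0 < s'\<close>, of 1 "diameter (U i)"] by (cases "diameter (U i) \<le> 1") auto
    then show "diameter (U i) powr t \<le> diameter (U i) powr s'"
      using t(2) diameter_ge_0[OF U, of i] by (intro powr_mono') auto
  qed
  also note sU
  finally obtain d where d: "\<And>i. 0 < d i" "\<And>i. diameter (U i) \<le> d i"
    and sd: "(\<Sum>i. ennreal (d i powr t)) \<le> ennreal (2 * \<epsilon>)"
    by (rule positive_diameter_bounds[OF t(1) \<epsilon>(1) U]) (rule that)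
  \<comment> \<open>The projection of \<open>U i\<close> to the first factor lies within
    \<open>d i\<close> of this point. For empty \<open>U i\<close> the choice is arbitrary and
    harmless.\<close>
  define c where "c i = fst (SOME u. u \<in> U i)" for i
  have c: "A \<in> cball (c i) (d i)" if "(A, b) \<in> U i" for A b i
  proof -
    have "(SOME u. u \<in> U i) \<in> U i" using that by (rule someI)
    then have "dist (SOME u. u \<in> U i) (A, b) \<le> d i"
      using diameter_bounded_bound[OF U _ that] d(2) order_trans by blast
    then show ?thesis using dist_fst_le[of "SOME u. u \<in> U i" "(A, b)"] by (simp add: c_def)
  qed
  have hs: "(\<Sum>i. ennreal (d i powr (DIM(real ^ 'n ^ 'm) + s))) \<le> ennreal (2 * \<epsilon>)"
    using sd unfolding dimA t_def by simp
  have h\<epsilon>: "2 * \<epsilon> < \<eta> * r ^ DIM(real ^ 'n ^ 'm)"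
    unfolding dimA by (rule \<epsilon>(3))
  obtain A where A: "A \<in> ball A0 r"
    and sA: "(\<Sum>i. ennreal (d i powr s) * indicator (cball (c i) (d i)) A) \<le> ennreal \<eta>"
    using exists_small_fibre[of d r \<eta> s "2 * \<epsilon>" A0 c, OF d(1) r(1) \<open>0 < \<eta>\<close> hs h\<epsilon>] by blast
  define F where "F i = {b. (A, b) \<in> U i}" for i
  have dF: "dist x y \<le> d i" if "x \<in> F i" "y \<in> F i" for x y i
    using diameter_bounded_bound[OF U, of "(A, x)" i "(A, y)"] d(2)[of i] that
    by (simp add: F_def dist_Pair_Pair)
  \<comment> \<open>A slice over \<open>A\<close> is nonempty only if \<open>A\<close> lies in the
    ball about \<open>c i\<close>, so the sum controlled at \<open>A\<close> dominates the hit
    sum.\<close>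
  have hit: "hit_sum s d F (cube b0 l) \<le> ennreal ((l / (4 * real M)) powr s)"
  proof -
    have "hit_sum s d F (cube b0 l) \<le> (\<Sum>i. ennreal (d i powr s) * indicator (cball (c i) (d i)) A)"
      unfolding hit_sum_def
    proof (intro suminf_le summableI)
      fix i
      show "(if F i \<inter> cube b0 l = {} then 0 else ennreal (d i powr s))
          \<le> ennreal (d i powr s) * indicator (cball (c i) (d i)) A"
      proof (cases "F i = {}")
        case False
        then have "A \<in> cball (c i) (d i)" using c by (auto simp: F_def)
        then show ?thesis by simp
      qed simp
    qed
    also note sA
    finally show ?thesis by (simp add: \<eta>_def)
  qed
  obtain b where b: "b \<in> cube b0 l" "b \<notin> (\<Union>i. F i)" "badly_approximable (A, b)"
    by (rule exists_bad_translate[OF \<open>2 \<le> S\<close> SM s(1) many d(1) _ l_def hit]) (erule (1) dF, erule (2) that)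
  have "A \<in> \<A>" "b \<in> \<B>" using A r(2) b(1) \<open>cube b0 l \<subseteq> \<B>\<close> by blast+
  then have "(A, b) \<in> W \<inter> BA_affine"
    using AB(5) b(3) unfolding BA_affine_def by blast
  then have "b \<in> (\<Union>i. F i)" using cover by (auto simp: F_def)
  with b show False by blast
qed

text \<open>The dimension of the ambient space bounds that of \<open>W\<close>, and the badly
  approximable part of \<open>W\<close> already attains it.\<close>

theorem theorem1p5:
  shows "thick_in (UNIV :: ((real ^ 'n ^ 'm) \<times> (real ^ 'm)) set) BA_affine"
  unfolding thick_in_def
proof (intro conjI allI impI subset_UNIV)
  fix W :: "((real ^ 'n ^ 'm) \<times> (real ^ 'm)) set"
  assume "openin (top_of_set UNIV) W \<and> W \<noteq> {}"
  then have "open W" "W \<noteq> {}" by auto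
  show "hausdorff_dim (W \<inter> BA_affine) = hausdorff_dim W"
  proof (rule antisym)
    show "hausdorff_dim (W \<inter> BA_affine) \<le> hausdorff_dim W"
      by (rule hausdorff_dim_mono) simp
    have "hausdorff_dim W \<le> ereal (CARD('m) * CARD('n) + CARD('m))"
      using hausdorff_dim_le_DIM[of W] by simp
    also have "\<dots> \<le> hausdorff_dim (W \<inter> BA_affine)"
      using \<open>open W\<close> \<open>W \<noteq> {}\<close> by (rule hausdorff_dim_BA_affine_ge)
    finally show "hausdorff_dim W \<le> hausdorff_dim (W \<inter> BA_affine)" .
  qed
qed

end
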